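(* Let $\varphi(z)$ be any nontrivial solution of the boundary value problem $$\varphi' - (\varphi')^2 + \varphi\varphi'' + \frac{2}{H}\int_0^H(\varphi'(z))^2\,dz = 0,\qquad \varphi(0)=\varphi(H)=0,$$ and let $k$ be any positive integer. Suppose that $(u(x,z,t),w(x,z,t))$ is a smooth solution of the two-dimensional inviscid primitive equations $$u_t+uu_x+wu_z+p_x=0,\qquad p_z=0,\qquad u_x+w_z=0$$ in the channel $M=\{(x,z): 0\le z\le H,\ x\in\mathbb{R}\}$, subject to the conditions (i) $w|_{z=H}=w|_{z=0}=0$; (ii) $u(x+L,z,t)=u(x,z,t)$, $p(x+L,z,t)=p(x,z,t)$, $w(x+L,z,t)=w(x,z,t)$; (iii) $u(x,z,t)=-u(-x,z,t)$, $p(x,z,t)=p(-x,z,t)$, $w(x,z,t)=w(-x,z,t)$; with initial value $$u_0(x,z)=\frac{-L}{2\pi k}\sin\Big(\frac{2\pi k}{L}x\Big)\varphi'(z)\quad\text{and}\quad w_0(x,z)=\cos\Big(\frac{2\pi k}{L}x\Big)\varphi(z).$$ Then this solution blows up in finite time.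
   Context: $H>0$ is the height of the channel and $L>0$ is the horizontal period. The functions $u=u(x,z,t)$ and $w=w(x,z,t)$ are the horizontal and vertical velocity components, and $p$ is the pressure, which together with $(u,w)$ satisfies the equations. Primes on $\varphi$ denote derivatives in $z\in[0,H]$, and "nontrivial" means not identically zero. "Blows up in finite time" means that the solution loses its smoothness at some finite time. *)

theory Defs
  imports "HOL-Analysis.Analysis"
begin

section \<open>Functions of class \<open>C\<^sup>r\<close> on a set\<close>

text \<open>
  The sets used below are convex with nonempty interior, so the derivative within the set
  is unique and, at boundary points, is the one-sided derivative.  Thus \<open>C\<^sup>n\<close> here means that
  all partial derivatives up to order \<open>n\<close> exist and are continuous up to the boundary.
\<close>

primrec Ck_on :: "nat \<Rightarrow> ('a::real_normed_vector \<Rightarrow> 'b::real_normed_vector) \<Rightarrow> 'a set \<Rightarrow> bool" where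
  "Ck_on 0 f S \<longleftrightarrow> continuous_on S f"
| "Ck_on (Suc n) f S \<longleftrightarrow>
     (\<exists>f'. (\<forall>q\<in>S. (f has_derivative f' q) (at q within S)) \<and> (\<forall>v. Ck_on n (\<lambda>q. f' q v) S))"

definition smooth_on_order ::
    "enat \<Rightarrow> ('a::real_normed_vector \<Rightarrow> 'b::real_normed_vector) \<Rightarrow> 'a set \<Rightarrow> bool" where
  "smooth_on_order r f S \<longleftrightarrow> (\<forall>n. enat n \<le> r \<longrightarrow> Ck_on n f S)"


section \<open>The profile equation\<close>

definition zderiv :: "real \<Rightarrow> (real \<Rightarrow> real) \<Rightarrow> real \<Rightarrow> real" where
  "zderiv H f z = vector_derivative f (at z within {0..H})"

definition profile_solution :: "real \<Rightarrow> (real \<Rightarrow> real) \<Rightarrow> bool" where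
  "profile_solution H \<phi> \<longleftrightarrow>
     \<phi> differentiable_on {0..H} \<and> zderiv H \<phi> differentiable_on {0..H} \<and>
     (\<forall>z\<in>{0..H}.
        zderiv H \<phi> z - (zderiv H \<phi> z)\<^sup>2 + \<phi> z * zderiv H (zderiv H \<phi>) z
          + 2 / H * integral {0..H} (\<lambda>s. (zderiv H \<phi> s)\<^sup>2) = 0) \<and>
     \<phi> 0 = 0 \<and> \<phi> H = 0"


section \<open>The inviscid primitive equations in the channel\<close>

text \<open>
  Scalar fields are curried functions of \<open>x\<close>, \<open>z\<close>, \<open>t\<close>; only their values for
  \<open>0 \<le> z \<le> H\<close> and \<open>0 \<le> t < T\<close> matter.  The time horizon \<open>T\<close> is an extended real, so that
  \<open>T = \<infinity>\<close> describes solutions that are global in time.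
\<close>

type_synonym field = "real \<Rightarrow> real \<Rightarrow> real \<Rightarrow> real"

definition time_set :: "ereal \<Rightarrow> real set" where
  "time_set T = {t. 0 \<le> t \<and> ereal t < T}"

text \<open>
  Smoothness has order \<open>r\<close> with \<open>1 \<le> r \<le> \<infinity>\<close>.  A nontrivial solution \<open>\<phi>\<close> of the profile equation
  is never \<open>C\<^sup>3\<close> up to the boundary of \<open>[0, H]\<close>: it has a zero with slope \<open>m > 1\<close>, from which
  \<open>\<phi>' - m\<close> behaves like a nonzero multiple of the power \<open>2 - 1/m\<close> of the distance.  So the initial
  velocity \<open>u\<^sub>0\<close> is \<open>C\<^sup>1\<close> but not \<open>C\<^sup>2\<close>, and finite orders, \<open>r = 1\<close> in particular, must be covered
  alongside \<open>r = \<infinity>\<close>.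
\<close>

definition smooth_field :: "enat \<Rightarrow> real \<Rightarrow> ereal \<Rightarrow> field \<Rightarrow> bool" where
  "smooth_field r H T f \<longleftrightarrow>
     smooth_on_order r (\<lambda>(x, z, t). f x z t) (UNIV \<times> {0..H} \<times> time_set T)"

definition partial_x :: "field \<Rightarrow> field" where
  "partial_x f x z t = vector_derivative (\<lambda>y. f y z t) (at x)"

definition partial_z :: "real \<Rightarrow> field \<Rightarrow> field" where
  "partial_z H f x z t = vector_derivative (\<lambda>y. f x y t) (at z within {0..H})"

definition partial_t :: "ereal \<Rightarrow> field \<Rightarrow> field" where
  "partial_t T f x z t = vector_derivative (\<lambda>s. f x z s) (at t within time_set T)"

definition primitive_equations :: "real \<Rightarrow> ereal \<Rightarrow> field \<Rightarrow> field \<Rightarrow> field \<Rightarrow> bool" where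
  "primitive_equations H T u w p \<longleftrightarrow>
     (\<forall>x. \<forall>z\<in>{0..H}. \<forall>t\<in>time_set T.
        partial_t T u x z t + u x z t * partial_x u x z t + w x z t * partial_z H u x z t
          + partial_x p x z t = 0 \<and>
        partial_z H p x z t = 0 \<and>
        partial_x u x z t + partial_z H w x z t = 0)"

definition no_flow_through :: "real \<Rightarrow> ereal \<Rightarrow> field \<Rightarrow> bool" where
  "no_flow_through H T w \<longleftrightarrow> (\<forall>x. \<forall>t\<in>time_set T. w x H t = 0 \<and> w x 0 t = 0)"

definition periodic_x :: "real \<Rightarrow> real \<Rightarrow> ereal \<Rightarrow> field \<Rightarrow> bool" where
  "periodic_x L H T f \<longleftrightarrow> (\<forall>x. \<forall>z\<in>{0..H}. \<forall>t\<in>time_set T. f (x + L) z t = f x z t)"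

definition odd_x :: "real \<Rightarrow> ereal \<Rightarrow> field \<Rightarrow> bool" where
  "odd_x H T f \<longleftrightarrow> (\<forall>x. \<forall>z\<in>{0..H}. \<forall>t\<in>time_set T. f x z t = - f (- x) z t)"

definition even_x :: "real \<Rightarrow> ereal \<Rightarrow> field \<Rightarrow> bool" where
  "even_x H T f \<longleftrightarrow> (\<forall>x. \<forall>z\<in>{0..H}. \<forall>t\<in>time_set T. f x z t = f (- x) z t)"

definition smooth_PE_solution ::
    "enat \<Rightarrow> real \<Rightarrow> real \<Rightarrow> ereal \<Rightarrow> field \<Rightarrow> field \<Rightarrow> bool" where
  "smooth_PE_solution r H L T u w \<longleftrightarrow>
     (\<exists>p. smooth_field r H T u \<and> smooth_field r H T w \<and> smooth_field r H T p \<and>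
        primitive_equations H T u w p \<and>
        no_flow_through H T w \<and>
        periodic_x L H T u \<and> periodic_x L H T p \<and> periodic_x L H T w \<and>
        odd_x H T u \<and> even_x H T p \<and> even_x H T w)"

definition initial_value ::
    "real \<Rightarrow> field \<Rightarrow> field \<Rightarrow> (real \<Rightarrow> real \<Rightarrow> real) \<Rightarrow> (real \<Rightarrow> real \<Rightarrow> real) \<Rightarrow> bool" where
  "initial_value H u w u0 w0 \<longleftrightarrow>
     (\<forall>x. \<forall>z\<in>{0..H}. u x z 0 = u0 x z \<and> w x z 0 = w0 x z)"


section \<open>Blow-up\<close>

text \<open>
  A continuation is not required to keep the pressure, which is determined by \<open>(u, w)\<close> only
  up to a function of time.
\<close>

definition smooth_continuation ::
    "enat \<Rightarrow> real \<Rightarrow> real \<Rightarrow> ereal \<Rightarrow> field \<Rightarrow> field \<Rightarrow> ereal \<Rightarrow> field \<Rightarrow> field \<Rightarrow> bool" where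
  "smooth_continuation r H L T u w T' u' w' \<longleftrightarrow>
     T \<le> T' \<and> smooth_PE_solution r H L T' u' w' \<and>
     (\<forall>x. \<forall>z\<in>{0..H}. \<forall>t\<in>time_set T. u' x z t = u x z t \<and> w' x z t = w x z t)"

definition lifespan :: "enat \<Rightarrow> real \<Rightarrow> real \<Rightarrow> ereal \<Rightarrow> field \<Rightarrow> field \<Rightarrow> ereal" where
  "lifespan r H L T u w = Sup {T'. \<exists>u' w'. smooth_continuation r H L T u w T' u' w'}"

text \<open>
  If \<open>(u, w)\<close> solves the equations smoothly on \<open>[0, T)\<close>, then \<open>T\<close> is at most the lifespan, and
  finite lifespan means that no smooth continuation reaches beyond that finite time; in
  particular \<open>T = \<infinity>\<close> is excluded.
\<close>

definition blows_up_in_finite_time :: "enat \<Rightarrow> real \<Rightarrow> real \<Rightarrow> ereal \<Rightarrow> field \<Rightarrow> field \<Rightarrow> bool" where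
  "blows_up_in_finite_time r H L T u w \<longleftrightarrow> lifespan r H L T u w < \<infinity>"

end

theory Submission
  imports Defs
begin

text \<open>
  By oddness the horizontal velocity vanishes on the axis \<open>x = 0\<close>, and there the vertical velocity
  \<open>W(z, t) = w(0, z, t)\<close> and its slope \<open>v = W\<^sub>z\<close> satisfy a closed nonlocal equation:
  \<open>W\<^sub>t + W v = 2 \<integral> v\<^sup>2 - c z\<close>, the integral being over \<open>[0, z]\<close>, where \<open>c\<close> is \<open>2 / H\<close> times the
  integral of \<open>v\<^sup>2\<close> over \<open>[0, H]\<close> (\<open>axis_reduction\<close>).  The self-similar function
  \<open>W = \<phi> / (1 - t)\<close> solves it with the given initial value.  The point is that the flow has to follow
  this solution, although only \<open>C\<^sup>1\<close> regularity is assumed.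

  Along the trajectories of \<open>W\<close> the slope satisfies the Riccati equation \<open>v' = v\<^sup>2 - c\<close>, and vertical
  lengths are stretched at the rate \<open>v\<close>.  The unknown function \<open>c\<close> is common to all trajectories, and
  all Riccati solutions are explicit in terms of a single one.  One trajectory is known in
  advance: the bottom \<open>z = 0\<close>.  With \<open>V = v(0, t)\<close>, \<open>\<sigma> = V(0) = \<phi>'(0)\<close>, \<open>J = exp (\<integral> V)\<close> and
  \<open>\<eta> = \<integral> J\<^sup>2\<close>, the stretching factor of a trajectory with initial slope \<open>s\<close> is
  \<open>J / (1 + (\<sigma> - s) \<eta>)\<close>.  Since the total length remains \<open>H\<close>,
  \<open>J \<integral> 1 / (1 + (\<sigma> - \<phi>') \<eta>) = H\<close> (\<open>lagrangian_volume\<close>), an autonomous differential equation for \<open>\<eta>\<close>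
  from which \<open>c\<close> has disappeared.  The proof does not construct trajectories: it tests the equation
  for \<open>v\<close> with suitable functions of \<open>v\<close> and \<open>t\<close> (\<open>moment_derivative\<close>), which is possible for
  continuous \<open>v\<close>.

  The profile equation evaluates the integral through a linear differential equation in \<open>\<eta>\<close>
  (\<open>slope_moments\<close>).  This gives \<open>V (1 + (2 \<sigma> - 1) \<eta>) = \<sigma> J\<^sup>2\<close>, hence
  \<open>1 + (2 \<sigma> - 1) \<eta> = (1 - t) J\<^sup>2\<close>, and the two are incompatible at \<open>t = 1\<close> because \<open>\<sigma> \<noteq> 0\<close>
  (\<open>no_unit_time_flow\<close>).  Therefore no continuation reaches beyond time \<open>1\<close>.
\<close>

section \<open>Difference quotients and integrals on intervals\<close>

lemma bounded_convergence_interval: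
  fixes f :: "nat \<Rightarrow> real \<Rightarrow> real"
  assumes int: "\<And>n. f n integrable_on {a..b}"
    and bound: "\<And>n x. x \<in> {a..b} \<Longrightarrow> \<bar>f n x\<bar> \<le> K"
    and lim: "\<And>x. x \<in> {a..b} \<Longrightarrow> (\<lambda>n. f n x) \<longlonglongrightarrow> g x"
  shows "(\<lambda>n. integral {a..b} (f n)) \<longlonglongrightarrow> integral {a..b} g"
  by (rule dominated_convergence(2)[where h = "\<lambda>_. K"]) (use assms in auto)

lemma difference_quotient_mean_value:
  fixes f :: "real \<Rightarrow> real"
  assumes "a < b"
    and deriv: "\<And>x. x \<in> {a..b} \<Longrightarrow> (f has_real_derivative f' x) (at x within {a..b})"
  shows "\<exists>x\<in>{a..b}. (f b - f a) / (b - a) = f' x"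
proof -
  have "\<exists>x\<in>{a..b}. f b - f a = f' x * (b - a)"
    by (rule mvt_very_simple) (use assms in \<open>auto simp: has_field_derivative_def\<close>)
  then show ?thesis
    using \<open>a < b\<close> by (auto simp: field_simps)
qed

text \<open>
  By the mean value theorem the quotients are values of the derivative at points squeezed
  towards \<open>z\<close>.  Both end points may move, and \<open>z\<close> may be an end point of the interval.
\<close>

lemma difference_quotient_tendsto:
  fixes f :: "real \<Rightarrow> real"
  assumes deriv: "\<And>x. x \<in> {a..b} \<Longrightarrow> (f has_real_derivative f' x) (at x within {a..b})"
    and cont: "continuous_on {a..b} f'"
    and z: "z \<in> {a..b}"
    and x: "\<And>n. x n \<in> {a..b}" "x \<longlonglongrightarrow> z"
    and y: "\<And>n. y n \<in> {a..b}" "y \<longlonglongrightarrow> z"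
    and less: "\<And>n. x n < y n"
  shows "(\<lambda>n. (f (y n) - f (x n)) / (y n - x n)) \<longlonglongrightarrow> f' z"
proof -
  have "\<exists>\<xi>\<in>{x n..y n}. (f (y n) - f (x n)) / (y n - x n) = f' \<xi>" for n
  proof (rule difference_quotient_mean_value[OF less])
    fix s assume "s \<in> {x n..y n}"
    then show "(f has_real_derivative f' s) (at s within {x n..y n})"
      using deriv[of s] x(1)[of n] y(1)[of n] by (auto intro: DERIV_subset)
  qed
  then obtain \<xi> where \<xi>: "\<And>n. \<xi> n \<in> {x n..y n}"
    and eq: "\<And>n. (f (y n) - f (x n)) / (y n - x n) = f' (\<xi> n)"
    by metis
  have "\<xi> \<longlonglongrightarrow> z"
    using \<xi> by (intro tendsto_sandwich[OF _ _ x(2) y(2)] always_eventually) auto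
  moreover have "\<xi> n \<in> {a..b}" for n
    using \<xi>[of n] x(1)[of n] y(1)[of n] by auto
  ultimately have "(\<lambda>n. f' (\<xi> n)) \<longlonglongrightarrow> f' z"
    by (intro continuous_on_tendsto_compose[OF cont]) (use z in auto)
  then show ?thesis
    by (simp add: eq)
qed

lemma has_real_derivative_of_integral_eq:
  fixes f g :: "real \<Rightarrow> real"
  assumes cont: "continuous_on {a..b} g"
    and eq: "\<And>t. t \<in> {a..b} \<Longrightarrow> f t - f a = integral {a..t} g"
    and t: "t \<in> {a..b}"
  shows "(f has_real_derivative g t) (at t within {a..b})"
proof -
  have "((\<lambda>t. f a + integral {a..t} g) has_real_derivative 0 + g t) (at t within {a..b})"
    by (intro DERIV_add DERIV_const integral_has_real_derivative cont t)
  then show ?thesis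
  proof (simp, elim has_field_derivative_transform_within[where d = 1])
    fix s assume "s \<in> {a..b}"
    from eq[OF this] show "f a + integral {a..s} g = f s" by simp
  qed (use t in auto)
qed

lemma integral_of_derivative:
  fixes f :: "real \<Rightarrow> real"
  assumes "a \<le> b"
    and "\<And>x. x \<in> {a..b} \<Longrightarrow> (f has_real_derivative f' x) (at x within {a..b})"
  shows "(f' has_integral f b - f a) {a..b}"
  by (rule fundamental_theorem_of_calculus)
     (use assms in \<open>auto simp: has_real_derivative_iff_has_vector_derivative\<close>)

lemma real_derivative_unique_Icc:
  fixes f g :: "real \<Rightarrow> real"
  assumes "a < b" "x \<in> {a..b}"
    and "(f has_real_derivative D) (at x within {a..b})"
    and "(g has_real_derivative E) (at x within {a..b})"
    and "\<And>y. y \<in> {a..b} \<Longrightarrow> f y = g y"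
  shows "D = E"
proof -
  have "(f has_real_derivative E) (at x within {a..b})"
    using assms(4) by (rule has_field_derivative_transform_within[where d = 1]) (use assms in auto)
  then show ?thesis
    using assms(1-3) vector_derivative_unique_within[of x "{a..b}" f D E]
    by (simp add: has_real_derivative_iff_has_vector_derivative trivial_limit_within islimpt_Icc)
qed

lemma bounded_on_box:
  fixes f :: "real \<Rightarrow> real \<Rightarrow> real"
  assumes "continuous_on ({a..b} \<times> {c..d}) (\<lambda>(x, y). f x y)"
  obtains K where "\<And>x y. x \<in> {a..b} \<Longrightarrow> y \<in> {c..d} \<Longrightarrow> \<bar>f x y\<bar> \<le> K" "0 \<le> K"
proof -
  have "bounded ((\<lambda>(x, y). f x y) ` ({a..b} \<times> {c..d}))"
    by (intro compact_imp_bounded compact_continuous_image assms compact_Times compact_Icc)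
  then obtain K where K: "\<forall>q\<in>{a..b} \<times> {c..d}. \<bar>(\<lambda>(x, y). f x y) q\<bar> \<le> K"
    by (auto simp: bounded_iff)
  have "\<bar>f x y\<bar> \<le> max K 0" if "x \<in> {a..b}" "y \<in> {c..d}" for x y
    using bspec[OF K, of "(x, y)"] that by auto
  then show ?thesis
    by (rule that) auto
qed

lemma bounded_on_interval:
  fixes f :: "real \<Rightarrow> real"
  assumes "continuous_on {a..b} f"
  obtains K where "\<And>x. x \<in> {a..b} \<Longrightarrow> \<bar>f x\<bar> \<le> K"
proof -
  have "bounded (f ` {a..b})"
    by (intro compact_imp_bounded compact_continuous_image assms compact_Icc)
  then obtain K where K: "\<forall>x\<in>{a..b}. \<bar>f x\<bar> \<le> K"
    by (auto simp: bounded_iff)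
  show ?thesis
    by (rule that[of K]) (use K in blast)
qed

section \<open>The equation on the symmetry axis\<close>

text \<open>
  The restriction of a solution to the axis \<open>x = 0\<close>: \<open>W\<close> is the vertical velocity there and
  \<open>v\<close> its slope, that is, minus the horizontal strain.  Differentiating the evolution law once
  more in \<open>z\<close> would give the familiar equation
  \<open>W\<^sub>z\<^sub>t - W\<^sub>z\<^sup>2 + W W\<^sub>z\<^sub>z + (2 / H) \<integral> W\<^sub>z\<^sup>2 = 0\<close>, but \<open>W\<close> is only \<open>C\<^sup>1\<close>, so that the law is kept
  in its integrated form.
\<close>

locale reduced_flow =
  fixes H \<tau> :: real and W v Wt :: "real \<Rightarrow> real \<Rightarrow> real"
  assumes H_pos: "0 < H" and \<tau>_pos: "0 < \<tau>"
    and W_cont: "continuous_on ({0..H} \<times> {0..\<tau>}) (\<lambda>(z, t). W z t)"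
    and v_cont: "continuous_on ({0..H} \<times> {0..\<tau>}) (\<lambda>(z, t). v z t)"
    and Wt_cont: "continuous_on ({0..H} \<times> {0..\<tau>}) (\<lambda>(z, t). Wt z t)"
    and W_z: "\<And>z t. z \<in> {0..H} \<Longrightarrow> t \<in> {0..\<tau>} \<Longrightarrow>
      ((\<lambda>y. W y t) has_real_derivative v z t) (at z within {0..H})"
    and W_t: "\<And>z t. z \<in> {0..H} \<Longrightarrow> t \<in> {0..\<tau>} \<Longrightarrow>
      ((\<lambda>s. W z s) has_real_derivative Wt z t) (at t within {0..\<tau>})"
    and W_bottom: "\<And>t. t \<in> {0..\<tau>} \<Longrightarrow> W 0 t = 0"
    and W_top: "\<And>t. t \<in> {0..\<tau>} \<Longrightarrow> W H t = 0"
    and W_evolution: "\<And>z t. z \<in> {0..H} \<Longrightarrow> t \<in> {0..\<tau>} \<Longrightarrow>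
      Wt z t = 2 * integral {0..z} (\<lambda>y. (v y t)\<^sup>2)
        - 2 / H * integral {0..H} (\<lambda>y. (v y t)\<^sup>2) * z - W z t * v z t"

section \<open>Continuously differentiable fields\<close>

text \<open>
  A field together with its partial derivatives on a compact time interval, all continuous up
  to the boundary of the channel.
\<close>

definition C1_field ::
    "real \<Rightarrow> real \<Rightarrow> field \<Rightarrow> field \<Rightarrow> field \<Rightarrow> field \<Rightarrow> bool" where
  "C1_field H \<tau> f fx fz ft \<longleftrightarrow>
     (\<forall>g\<in>{f, fx, fz, ft}. continuous_on (UNIV \<times> {0..H} \<times> {0..\<tau>}) (\<lambda>(x, z, t). g x z t)) \<and>
     (\<forall>x. \<forall>z\<in>{0..H}. \<forall>t\<in>{0..\<tau>}.
        ((\<lambda>y. f y z t) has_real_derivative fx x z t) (at x) \<and>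
        ((\<lambda>y. f x y t) has_real_derivative fz x z t) (at z within {0..H}) \<and>
        ((\<lambda>s. f x z s) has_real_derivative ft x z t) (at t within {0..\<tau>}))"

text \<open>
  The partial derivatives of the definitions are values of the total derivative in coordinate
  directions.  The strict inequality \<open>\<tau> < T\<close> puts \<open>[0, \<tau>]\<close> into the time domain, where one-sided
  derivatives at \<open>\<tau>\<close> agree with those taken within the larger set.
\<close>

lemma smooth_field_C1:
  assumes smooth: "smooth_field r H T f" and "1 \<le> r" and H: "0 < H" and \<tau>: "0 < \<tau>" "ereal \<tau> < T"
  shows "C1_field H \<tau> f (partial_x f) (partial_z H f) (partial_t T f)"
proof -
  define S where "S = (UNIV :: real set) \<times> {0..H} \<times> time_set T"
  define F where "F = (\<lambda>(x :: real, z :: real, t :: real). f x z t)"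
  have "Ck_on (Suc 0) F S"
    using smooth \<open>1 \<le> r\<close> unfolding smooth_field_def smooth_on_order_def S_def F_def
    by (metis One_nat_def one_enat_def)
  then obtain F' where F': "\<And>q. q \<in> S \<Longrightarrow> (F has_derivative F' q) (at q within S)"
    and cont: "\<And>v. continuous_on S (\<lambda>q. F' q v)"
    by auto
  have sub: "{0..\<tau>} \<subseteq> time_set T"
    using \<tau>(2) by (auto simp: time_set_def intro: le_less_trans[of "ereal _" "ereal \<tau>"])
  have line: "((\<lambda>s. F (q + (s - s0) *\<^sub>R v)) has_vector_derivative F' q v) (at s0 within A)"
    if q: "q \<in> S" and A: "\<And>s. s \<in> A \<Longrightarrow> q + (s - s0) *\<^sub>R v \<in> S" for q v s0 A
  proof -
    have "((\<lambda>s. q + (s - s0) *\<^sub>R v) has_derivative (\<lambda>h. h *\<^sub>R v)) (at s0 within A)"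
      by (auto intro!: derivative_eq_intros)
    moreover have "(F has_derivative F' q) (at (q + (s0 - s0) *\<^sub>R v) within (\<lambda>s. q + (s - s0) *\<^sub>R v) ` A)"
      using A F'[OF q] by (auto intro: has_derivative_subset)
    ultimately have "((\<lambda>s. F (q + (s - s0) *\<^sub>R v)) has_derivative (\<lambda>h. F' q (h *\<^sub>R v))) (at s0 within A)"
      by (rule has_derivative_in_compose)
    moreover have "F' q (h *\<^sub>R v) = h *\<^sub>R F' q v" for h
      using has_derivative_linear[OF F'[OF q]] by (simp add: linear_cmul)
    ultimately show ?thesis
      by (simp add: has_vector_derivative_def)
  qed
  have x: "((\<lambda>y. f y z t) has_vector_derivative F' (x, z, t) (1, 0, 0)) (at x)"
    and z: "((\<lambda>y. f x y t) has_vector_derivative F' (x, z, t) (0, 1, 0)) (at z within {0..H})"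
    and t: "((\<lambda>s. f x z s) has_vector_derivative F' (x, z, t) (0, 0, 1)) (at t within time_set T)"
    if "z \<in> {0..H}" "t \<in> {0..\<tau>}" for x z t
    using that sub line[of "(x, z, t)" UNIV x "(1, 0, 0)"] line[of "(x, z, t)" "{0..H}" z "(0, 1, 0)"]
      line[of "(x, z, t)" "time_set T" t "(0, 0, 1)"]
    by (auto simp: S_def F_def)
  have nb_t: "at t within time_set T \<noteq> bot" if "t \<in> {0..\<tau>}" for t
  proof -
    have "at t within {0..\<tau>} \<noteq> bot"
      using that \<tau>(1) by (simp add: trivial_limit_within islimpt_Icc)
    moreover have "at t within {0..\<tau>} \<le> at t within time_set T"
      by (rule at_le[OF sub])
    ultimately show ?thesis
      by (metis bot.extremum_uniqueI)
  qed
  have px: "partial_x f x z t = F' (x, z, t) (1, 0, 0)"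
    and pz: "partial_z H f x z t = F' (x, z, t) (0, 1, 0)"
    and pt: "partial_t T f x z t = F' (x, z, t) (0, 0, 1)"
    if *: "z \<in> {0..H}" "t \<in> {0..\<tau>}" for x z t
    unfolding partial_x_def partial_z_def partial_t_def
    using x[OF *, of x] z[OF *, of x] t[OF *, of x] nb_t[OF *(2)] H *(1)
    by (auto intro!: vector_derivative_at vector_derivative_within simp: trivial_limit_within islimpt_Icc)
  have sub': "UNIV \<times> {0..H} \<times> {0..\<tau>} \<subseteq> S"
    using sub by (auto simp: S_def)
  have cF: "continuous_on (UNIV \<times> {0..H} \<times> {0..\<tau>}) (\<lambda>(x, z, t). f x z t)"
    using has_derivative_continuous_on[OF F'] sub' continuous_on_subset unfolding F_def by blast
  have cF': "continuous_on (UNIV \<times> {0..H} \<times> {0..\<tau>}) (\<lambda>(x, z, t). F' (x, z, t) v)" for v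
    using continuous_on_subset[OF cont sub'] by (simp add: case_prod_unfold)
  have c: "continuous_on (UNIV \<times> {0..H} \<times> {0..\<tau>}) (\<lambda>(x, z, t). partial_x f x z t)"
      "continuous_on (UNIV \<times> {0..H} \<times> {0..\<tau>}) (\<lambda>(x, z, t). partial_z H f x z t)"
      "continuous_on (UNIV \<times> {0..H} \<times> {0..\<tau>}) (\<lambda>(x, z, t). partial_t T f x z t)"
    by (rule continuous_on_eq[OF cF'], use px pz pt in force)+
  show ?thesis
    unfolding C1_field_def
    using c cF x z has_vector_derivative_within_subset[OF t sub]
    by (auto simp: has_real_derivative_iff_has_vector_derivative px pz pt)
qed

section \<open>Reduction to the symmetry axis\<close>

lemma C1_field_continuous:
  assumes "C1_field H \<tau> f fx fz ft" and "g \<in> {f, fx, fz, ft}"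
    and "continuous_on A a" "continuous_on A b" "continuous_on A c"
    and "\<And>s. s \<in> A \<Longrightarrow> b s \<in> {0..H}" "\<And>s. s \<in> A \<Longrightarrow> c s \<in> {0..\<tau>}"
  shows "continuous_on A (\<lambda>s. g (a s) (b s) (c s))"
proof -
  have "continuous_on (UNIV \<times> {0..H} \<times> {0..\<tau>}) (\<lambda>(x, z, t). g x z t)"
    using assms(1,2) by (auto simp: C1_field_def)
  then have "continuous_on A (\<lambda>s. (\<lambda>(x, z, t). g x z t) (a s, b s, c s))"
    by (rule continuous_on_compose2) (use assms in \<open>auto intro!: continuous_intros\<close>)
  then show ?thesis by simp
qed

text \<open>
  For a \<open>C\<^sup>2\<close> flow one would differentiate the momentum equation in \<open>x\<close> at \<open>x = 0\<close>.  For a \<open>C\<^sup>1\<close>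
  flow the same information is obtained by integrating the momentum equation over \<open>[0, z]\<close>,
  where \<open>w u\<^sub>z = (w u)\<^sub>z + u u\<^sub>x\<close>, dividing by \<open>x\<close> and letting \<open>x\<close> tend to \<open>0\<close>.  Two devices
  avoid second derivatives: the horizontal flux \<open>\<integral> u\<close> over \<open>[0, z]\<close> equals
  \<open>- \<integral> w\<close> over \<open>[0, x]\<close>, so that the time derivative of the former divided by \<open>x\<close> tends to
  \<open>- w\<^sub>t\<close> on the axis; and the flux through the full height vanishes, which determines the
  pressure gradient.
\<close>

lemma axis_reduction:
  assumes "0 < H" and \<tau>: "0 < \<tau>"
    and Cu: "C1_field H \<tau> u ux uz ut"
    and Cw: "C1_field H \<tau> w wx wz wt"
    and Cp: "C1_field H \<tau> p px pz pt"
    and momentum: "\<And>x z t. z \<in> {0..H} \<Longrightarrow> t \<in> {0..\<tau>} \<Longrightarrow>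
      ut x z t + u x z t * ux x z t + w x z t * uz x z t + px x z t = 0"
    and hydrostatic: "\<And>x z t. z \<in> {0..H} \<Longrightarrow> t \<in> {0..\<tau>} \<Longrightarrow> pz x z t = 0"
    and incompressible: "\<And>x z t. z \<in> {0..H} \<Longrightarrow> t \<in> {0..\<tau>} \<Longrightarrow> ux x z t + wz x z t = 0"
    and no_flow: "\<And>x t. t \<in> {0..\<tau>} \<Longrightarrow> w x H t = 0 \<and> w x 0 t = 0"
    and u_axis: "\<And>z t. z \<in> {0..H} \<Longrightarrow> t \<in> {0..\<tau>} \<Longrightarrow> u 0 z t = 0"
  shows "reduced_flow H \<tau> (w 0) (wz 0) (wt 0)"
proof
  show "0 < H" "0 < \<tau>" by fact+
  note cont = C1_field_continuous[OF Cu, where g = u, simplified]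
    C1_field_continuous[OF Cu, where g = ux, simplified]
    C1_field_continuous[OF Cu, where g = ut, simplified]
    C1_field_continuous[OF Cw, where g = w, simplified]
    C1_field_continuous[OF Cw, where g = wz, simplified]
    C1_field_continuous[OF Cw, where g = wt, simplified]
  show "continuous_on ({0..H} \<times> {0..\<tau>}) (\<lambda>(z, t). w 0 z t)"
    "continuous_on ({0..H} \<times> {0..\<tau>}) (\<lambda>(z, t). wz 0 z t)"
    "continuous_on ({0..H} \<times> {0..\<tau>}) (\<lambda>(z, t). wt 0 z t)"
    by (auto simp: case_prod_unfold intro!: cont continuous_intros)
  have u_x: "((\<lambda>y. u y z t) has_real_derivative ux x z t) (at x within A)"
    and u_z: "((\<lambda>y. u x y t) has_real_derivative uz x z t) (at z within {0..H})"
    and u_t: "((\<lambda>s. u x z s) has_real_derivative ut x z t) (at t within {0..\<tau>})"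
    and w_z: "((\<lambda>y. w x y t) has_real_derivative wz x z t) (at z within {0..H})"
    and w_t: "((\<lambda>s. w x z s) has_real_derivative wt x z t) (at t within {0..\<tau>})"
    and p_x: "((\<lambda>y. p y z t) has_real_derivative px x z t) (at x)"
    and p_z: "((\<lambda>y. p x y t) has_real_derivative pz x z t) (at z within {0..H})"
    if "z \<in> {0..H}" "t \<in> {0..\<tau>}" for x z t A
    using that Cu Cw Cp by (auto simp: C1_field_def intro: has_field_derivative_at_within)
  show "((\<lambda>y. w 0 y t) has_real_derivative wz 0 z t) (at z within {0..H})"
    "((\<lambda>s. w 0 z s) has_real_derivative wt 0 z t) (at t within {0..\<tau>})"
    if "z \<in> {0..H}" "t \<in> {0..\<tau>}" for z t
    using w_z w_t that by auto
  show "w 0 0 t = 0" "w 0 H t = 0" if "t \<in> {0..\<tau>}" for t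
    using no_flow that by auto
  (* Both sides are the stream function of the flow. *)
  have stream: "integral {0..z} (\<lambda>\<zeta>. u x \<zeta> t) = - integral {0..x} (\<lambda>\<xi>. w \<xi> z t)"
    if "0 < x" and z: "z \<in> {0..H}" and t: "t \<in> {0..\<tau>}" for x z t
  proof -
    have sum0: "((\<lambda>x. integral {0..z} (\<lambda>\<zeta>. u x \<zeta> t) + integral {0..x} (\<lambda>\<xi>. w \<xi> z t))
        has_real_derivative 0) (at y within {0..x})" if y: "y \<in> {0..x}" for y
    proof -
      have "((\<lambda>x. integral (cbox 0 z) (\<lambda>\<zeta>. u x \<zeta> t)) has_real_derivative
          integral (cbox 0 z) (\<lambda>\<zeta>. ux y \<zeta> t)) (at y within {0..x})"
        by (rule leibniz_rule_field_derivative)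
           (use z t y in \<open>auto intro!: u_x integrable_continuous_interval cont continuous_intros
              simp: case_prod_unfold\<close>)
      moreover have "integral {0..z} (\<lambda>\<zeta>. ux y \<zeta> t) = - w y z t"
      proof -
        have "((\<lambda>\<zeta>. wz y \<zeta> t) has_integral w y z t - w y 0 t) {0..z}"
          using z t by (intro integral_of_derivative) (auto intro: DERIV_subset[OF w_z])
        then have "((\<lambda>\<zeta>. - wz y \<zeta> t) has_integral - w y z t) {0..z}"
          using no_flow[OF t] by (auto dest: has_integral_neg)
        then have "((\<lambda>\<zeta>. ux y \<zeta> t) has_integral - w y z t) {0..z}"
          by (rule has_integral_eq[rotated]) (use incompressible[of _ t y] z t in \<open>auto simp: minus_equation_iff add_eq_0_iff\<close>)
        then show ?thesis by (rule integral_unique)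
      qed
      moreover have "((\<lambda>x. integral {0..x} (\<lambda>\<xi>. w \<xi> z t)) has_real_derivative w y z t) (at y within {0..x})"
        by (intro integral_has_real_derivative y)
           (use z t in \<open>auto intro!: cont continuous_intros\<close>)
      ultimately show ?thesis
        by (auto dest: DERIV_add)
    qed
    obtain k where k: "\<forall>y\<in>{0..x}. integral {0..z} (\<lambda>\<zeta>. u y \<zeta> t) + integral {0..y} (\<lambda>\<xi>. w \<xi> z t) = k"
      using has_field_derivative_zero_constant[OF convex_real_interval(5) sum0] by blast
    have "integral {0..z} (\<lambda>\<zeta>. u 0 \<zeta> t) = 0"
      by (rule integral_unique, rule has_integral_is_0) (use u_axis z t in auto)
    moreover have "integral {0..0} (\<lambda>\<xi>. w \<xi> z t) = 0" by simp
    ultimately have "k = 0" using bspec[OF k, of 0] \<open>0 < x\<close> by simp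
    then show ?thesis using bspec[OF k, of x] \<open>0 < x\<close> by (simp add: eq_neg_iff_add_eq_0)
  qed
  have stream_t: "integral {0..z} (\<lambda>\<zeta>. ut x \<zeta> t) = - integral {0..x} (\<lambda>\<xi>. wt \<xi> z t)"
    if "0 < x" and z: "z \<in> {0..H}" and t: "t \<in> {0..\<tau>}" for x z t
  proof (rule real_derivative_unique_Icc[OF \<tau> t])
    have "((\<lambda>t. integral (cbox 0 z) (\<lambda>\<zeta>. u x \<zeta> t)) has_real_derivative
        integral (cbox 0 z) (\<lambda>\<zeta>. ut x \<zeta> t)) (at t within {0..\<tau>})"
      by (rule leibniz_rule_field_derivative)
         (use z t in \<open>auto intro!: u_t integrable_continuous_interval cont continuous_intros
            simp: case_prod_unfold\<close>)
    then show "((\<lambda>t. integral {0..z} (\<lambda>\<zeta>. u x \<zeta> t)) has_real_derivative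
        integral {0..z} (\<lambda>\<zeta>. ut x \<zeta> t)) (at t within {0..\<tau>})" by simp
    have "((\<lambda>t. integral (cbox 0 x) (\<lambda>\<xi>. w \<xi> z t)) has_real_derivative
        integral (cbox 0 x) (\<lambda>\<xi>. wt \<xi> z t)) (at t within {0..\<tau>})"
      by (rule leibniz_rule_field_derivative)
         (use z t in \<open>auto intro!: w_t integrable_continuous_interval cont continuous_intros
            simp: case_prod_unfold\<close>)
    then show "((\<lambda>t. - integral {0..x} (\<lambda>\<xi>. w \<xi> z t)) has_real_derivative
        - integral {0..x} (\<lambda>\<xi>. wt \<xi> z t)) (at t within {0..\<tau>})"
      by (auto dest: DERIV_minus)
    show "integral {0..z} (\<lambda>\<zeta>. u x \<zeta> y) = - integral {0..x} (\<lambda>\<xi>. w \<xi> z y)" if "y \<in> {0..\<tau>}" for y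
      using stream that \<open>0 < x\<close> z by blast
  qed
  have px_const: "px x z t = px x 0 t" if z: "z \<in> {0..H}" and t: "t \<in> {0..\<tau>}" for x z t
  proof -
    have "p y z t = p y 0 t" for y
    proof -
      have "\<exists>k. \<forall>z\<in>{0..H}. p y z t = k"
        by (rule has_field_derivative_zero_constant) (use hydrostatic t p_z in fastforce)+
      then show ?thesis using z \<open>0 < H\<close> by fastforce
    qed
    then have "((\<lambda>y. p y 0 t) has_real_derivative px x z t) (at x)"
      using p_x[OF z t, of x] by simp
    then show ?thesis
      using DERIV_unique p_x[of 0 t x] \<open>0 < H\<close> t by auto
  qed
  have integrated: "integral {0..z} (\<lambda>\<zeta>. ut x \<zeta> t) =
      - 2 * integral {0..z} (\<lambda>\<zeta>. u x \<zeta> t * ux x \<zeta> t) - w x z t * u x z t - z * px x 0 t"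
    if z: "z \<in> {0..H}" and t: "t \<in> {0..\<tau>}" for x z t
  proof -
    have "((\<lambda>\<zeta>. u x \<zeta> t * ux x \<zeta> t) has_integral integral {0..z} (\<lambda>\<zeta>. u x \<zeta> t * ux x \<zeta> t)) {0..z}"
      by (intro integrable_integral integrable_continuous_interval)
         (use z t in \<open>auto intro!: cont continuous_intros\<close>)
    then have 1: "((\<lambda>\<zeta>. - 2 * (u x \<zeta> t * ux x \<zeta> t)) has_integral
        - 2 * integral {0..z} (\<lambda>\<zeta>. u x \<zeta> t * ux x \<zeta> t)) {0..z}"
      by (rule has_integral_mult_right)
    have 2: "((\<lambda>\<zeta>. wz x \<zeta> t * u x \<zeta> t + uz x \<zeta> t * w x \<zeta> t) has_integral
        w x z t * u x z t - w x 0 t * u x 0 t) {0..z}"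
      using z t by (intro integral_of_derivative)
        (auto intro!: DERIV_mult intro: DERIV_subset[OF w_z] DERIV_subset[OF u_z])
    have 3: "((\<lambda>\<zeta>. px x 0 t) has_integral z * px x 0 t) {0..z}"
      using has_integral_const_real[of "px x 0 t" 0 z] z by simp
    have "((\<lambda>\<zeta>. ut x \<zeta> t) has_integral
      - 2 * integral {0..z} (\<lambda>\<zeta>. u x \<zeta> t * ux x \<zeta> t) - (w x z t * u x z t - w x 0 t * u x 0 t) - z * px x 0 t) {0..z}"
    proof (rule has_integral_eq[OF _ has_integral_diff[OF has_integral_diff[OF 1 2] 3]])
      fix \<zeta> assume "\<zeta> \<in> {0..z}"
      then have \<zeta>: "\<zeta> \<in> {0..H}" using z by auto
      have "wz x \<zeta> t = - ux x \<zeta> t" using incompressible[OF \<zeta> t, of x] by linarith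
      then show "- 2 * (u x \<zeta> t * ux x \<zeta> t) - (wz x \<zeta> t * u x \<zeta> t + uz x \<zeta> t * w x \<zeta> t) - px x 0 t = ut x \<zeta> t"
        using momentum[OF \<zeta> t, of x] px_const[OF \<zeta> t, of x] by (simp add: algebra_simps)
    qed
    then show ?thesis
      using no_flow[OF t] by (simp add: integral_unique)
  qed
  fix z t :: real
  assume z: "z \<in> {0..H}" and t: "t \<in> {0..\<tau>}"
  (* The flux through the whole height is zero at all times, so its time derivative drops out. *)
  have pressure: "px x 0 t = - 2 / H * integral {0..H} (\<lambda>\<zeta>. u x \<zeta> t * ux x \<zeta> t)" if "0 < x" for x
  proof -
    have "wt \<xi> H t = 0" for \<xi>
      by (rule real_derivative_unique_Icc[OF \<tau> t w_t DERIV_const[of 0]])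
         (use no_flow t \<open>0 < H\<close> in auto)
    then have "integral {0..H} (\<lambda>\<zeta>. ut x \<zeta> t) = 0"
      using stream_t[of x H t] that t \<open>0 < H\<close> by simp
    then show ?thesis
      using integrated[of H t x] no_flow[OF t, of x] t \<open>0 < H\<close> by (simp add: field_simps)
  qed
  define X where "X n = inverse (real (Suc n))" for n
  have X: "0 < X n" "X n \<in> {0..1}" for n
    by (auto simp: X_def divide_simps)
  have X_lim: "X \<longlonglongrightarrow> 0"
    unfolding X_def by (rule LIMSEQ_inverse_real_of_nat)
  have u_quot: "(\<lambda>n. u (X n) \<zeta> t / X n) \<longlonglongrightarrow> ux 0 \<zeta> t" if "\<zeta> \<in> {0..H}" for \<zeta>
  proof -
    have "(\<lambda>n. (u (X n) \<zeta> t - u 0 \<zeta> t) / (X n - 0)) \<longlonglongrightarrow> ux 0 \<zeta> t"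
      by (rule difference_quotient_tendsto[of 0 1])
         (use X X_lim that t in \<open>auto intro!: cont u_x continuous_intros\<close>)
    then show ?thesis
      using u_axis[OF that t] by simp
  qed
  have ux_lim: "(\<lambda>n. ux (X n) \<zeta> t) \<longlonglongrightarrow> ux 0 \<zeta> t" if "\<zeta> \<in> {0..H}" for \<zeta>
    by (rule continuous_on_tendsto_compose[of "{0..1}" "\<lambda>x. ux x \<zeta> t", OF _ X_lim])
       (use that t X in \<open>auto intro!: cont continuous_intros\<close>)
  have w_lim: "(\<lambda>n. w (X n) z t) \<longlonglongrightarrow> w 0 z t"
    by (rule continuous_on_tendsto_compose[of "{0..1}" "\<lambda>x. w x z t", OF _ X_lim])
       (use z t X in \<open>auto intro!: cont continuous_intros\<close>)
  have "continuous_on ({0..1} \<times> {0..H}) (\<lambda>(x, \<zeta>). ux x \<zeta> t)"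
    using t by (auto simp: case_prod_unfold intro!: cont continuous_intros)
  then obtain K where K: "\<And>x \<zeta>. x \<in> {0..1} \<Longrightarrow> \<zeta> \<in> {0..H} \<Longrightarrow> \<bar>ux x \<zeta> t\<bar> \<le> K" and "0 \<le> K"
    using bounded_on_box by blast
  have u_bound: "\<bar>u (X n) \<zeta> t / X n\<bar> \<le> K" if "\<zeta> \<in> {0..H}" for n \<zeta>
  proof -
    have "\<exists>x\<in>{0..X n}. (u (X n) \<zeta> t - u 0 \<zeta> t) / (X n - 0) = ux x \<zeta> t"
      by (rule difference_quotient_mean_value) (use X t that in \<open>auto intro!: u_x\<close>)
    then show ?thesis
      using K X[of n] that u_axis t by (fastforce simp: abs_divide)
  qed
  have quad: "(\<lambda>n. integral {0..y} (\<lambda>\<zeta>. u (X n) \<zeta> t / X n * ux (X n) \<zeta> t))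
      \<longlonglongrightarrow> integral {0..y} (\<lambda>\<zeta>. (wz 0 \<zeta> t)\<^sup>2)" if y: "y \<in> {0..H}" for y
  proof (rule bounded_convergence_interval[where K = "K * K"])
    show "(\<lambda>\<zeta>. u (X n) \<zeta> t / X n * ux (X n) \<zeta> t) integrable_on {0..y}" for n
      using X[of n] y t by (auto intro!: integrable_continuous_interval cont continuous_intros)
    fix \<zeta> assume "\<zeta> \<in> {0..y}"
    then have \<zeta>: "\<zeta> \<in> {0..H}" using y by auto
    show "\<bar>u (X n) \<zeta> t / X n * ux (X n) \<zeta> t\<bar> \<le> K * K" for n
      unfolding abs_mult by (intro mult_mono u_bound K X \<zeta> \<open>0 \<le> K\<close>) auto
    have "(wz 0 \<zeta> t)\<^sup>2 = ux 0 \<zeta> t * ux 0 \<zeta> t"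
      using incompressible[OF \<zeta> t, of 0] by (simp add: add_eq_0_iff power2_eq_square)
    then show "(\<lambda>n. u (X n) \<zeta> t / X n * ux (X n) \<zeta> t) \<longlonglongrightarrow> (wz 0 \<zeta> t)\<^sup>2"
      using tendsto_mult[OF u_quot[OF \<zeta>] ux_lim[OF \<zeta>]] by simp
  qed
  have wt_quot: "(\<lambda>n. integral {0..X n} (\<lambda>\<xi>. wt \<xi> z t) / X n) \<longlonglongrightarrow> wt 0 z t"
  proof -
    have "(\<lambda>n. (integral {0..X n} (\<lambda>\<xi>. wt \<xi> z t) - integral {0..0} (\<lambda>\<xi>. wt \<xi> z t)) / (X n - 0))
        \<longlonglongrightarrow> wt 0 z t"
      by (rule difference_quotient_tendsto[of 0 1])
         (use X X_lim z t in \<open>auto intro!: cont integral_has_real_derivative continuous_intros\<close>)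
    then show ?thesis by simp
  qed
  have balance: "integral {0..X n} (\<lambda>\<xi>. wt \<xi> z t) / X n =
      2 * integral {0..z} (\<lambda>\<zeta>. u (X n) \<zeta> t / X n * ux (X n) \<zeta> t)
      + w (X n) z t * (u (X n) z t / X n)
      - 2 / H * integral {0..H} (\<lambda>\<zeta>. u (X n) \<zeta> t / X n * ux (X n) \<zeta> t) * z" for n
  proof -
    have *: "integral {0..y} (\<lambda>\<zeta>. u (X n) \<zeta> t / X n * ux (X n) \<zeta> t) =
        integral {0..y} (\<lambda>\<zeta>. u (X n) \<zeta> t * ux (X n) \<zeta> t) / X n" for y
      by (simp flip: integral_divide)
    show ?thesis
      using stream_t[OF X(1) z t, of n] integrated[OF z t, of "X n"] pressure[OF X(1), of n] X(1)[of n]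
      unfolding * by (simp add: field_simps)
  qed
  have "(\<lambda>n. integral {0..X n} (\<lambda>\<xi>. wt \<xi> z t) / X n) \<longlonglongrightarrow>
      2 * integral {0..z} (\<lambda>\<zeta>. (wz 0 \<zeta> t)\<^sup>2) + w 0 z t * ux 0 z t
      - 2 / H * integral {0..H} (\<lambda>\<zeta>. (wz 0 \<zeta> t)\<^sup>2) * z"
    unfolding balance using z \<open>0 < H\<close>
    by (intro tendsto_intros quad w_lim u_quot) auto
  from LIMSEQ_unique[OF wt_quot this]
  show "wt 0 z t = 2 * integral {0..z} (\<lambda>y. (wz 0 y t)\<^sup>2)
      - 2 / H * integral {0..H} (\<lambda>y. (wz 0 y t)\<^sup>2) * z - w 0 z t * wz 0 z t"
    using incompressible[OF z t, of 0] by (simp add: add_eq_0_iff)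
qed

section \<open>Moments of the axial strain\<close>

context reduced_flow
begin

definition pressure_term :: "real \<Rightarrow> real" where
  "pressure_term t = 2 / H * integral {0..H} (\<lambda>z. (v z t)\<^sup>2)"

lemma W_comp_cont: "continuous_on A (\<lambda>s. W (f s) (g s))"
  and v_comp_cont: "continuous_on A (\<lambda>s. v (f s) (g s))"
  and Wt_comp_cont: "continuous_on A (\<lambda>s. Wt (f s) (g s))"
  if "continuous_on A f" "continuous_on A g"
    and "\<And>s. s \<in> A \<Longrightarrow> f s \<in> {0..H}" "\<And>s. s \<in> A \<Longrightarrow> g s \<in> {0..\<tau>}"
proof -
  have pair: "continuous_on A (\<lambda>s. (f s, g s))" "(\<lambda>s. (f s, g s)) ` A \<subseteq> {0..H} \<times> {0..\<tau>}"
    using that by (auto intro!: continuous_intros)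
  show "continuous_on A (\<lambda>s. W (f s) (g s))" "continuous_on A (\<lambda>s. v (f s) (g s))"
    "continuous_on A (\<lambda>s. Wt (f s) (g s))"
    using continuous_on_compose2[OF W_cont pair] continuous_on_compose2[OF v_cont pair]
      continuous_on_compose2[OF Wt_cont pair] by simp_all
qed

lemma pressure_term_cont: "continuous_on {0..\<tau>} pressure_term"
proof -
  have "continuous_on {0..\<tau>} (\<lambda>t. integral (cbox 0 H) (\<lambda>z. (v z t)\<^sup>2))"
    by (rule integral_continuous_on_param)
       (auto simp: case_prod_unfold intro!: v_comp_cont continuous_intros)
  then show ?thesis
    unfolding pressure_term_def using H_pos by (auto intro!: continuous_intros)
qed

text \<open>
  The material derivative \<open>W\<^sub>t + W W\<^sub>z\<close>.  Unlike \<open>Wt\<close> it is continuously differentiable in \<open>z\<close>.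
\<close>

definition acceleration :: "real \<Rightarrow> real \<Rightarrow> real" where
  "acceleration z t = 2 * integral {0..z} (\<lambda>y. (v y t)\<^sup>2) - pressure_term t * z"

lemma acceleration_z:
  assumes "z \<in> {0..H}" "t \<in> {0..\<tau>}"
  shows "((\<lambda>z. acceleration z t) has_real_derivative 2 * (v z t)\<^sup>2 - pressure_term t) (at z within {0..H})"
  unfolding acceleration_def using assms
  by (auto intro!: derivative_eq_intros integral_has_real_derivative v_comp_cont continuous_intros)

lemma Wt_eq:
  assumes "z \<in> {0..H}" "t \<in> {0..\<tau>}"
  shows "Wt z t = acceleration z t - W z t * v z t"
  unfolding acceleration_def pressure_term_def using W_evolution assms by simp

text \<open>
  Formally \<open>v\<^sub>t + W v\<^sub>z = v\<^sup>2 - c\<close> with \<open>c\<close> the pressure term, and the identity follows by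
  differentiating under the integral sign and integrating \<open>- W \<gamma>(b v + e)\<^sub>z\<close> by parts, which
  contributes the last summand because \<open>W\<^sub>z = v\<close>.  As \<open>v\<close> is merely continuous, \<open>v\<close> is replaced by
  difference quotients \<open>Q\<close> of \<open>W\<close>, which are \<open>C\<^sup>1\<close>.  The identity
  \<open>W\<^sub>2 v\<^sub>2 - W\<^sub>1 v\<^sub>1 = (W\<^sub>2 - W\<^sub>1) B + S (v\<^sub>2 - v\<^sub>1)\<close>, with averages \<open>S\<close> of \<open>W\<^sub>1, W\<^sub>2\<close> and \<open>B\<close> of \<open>v\<^sub>2, v\<^sub>1\<close>
  in opposite weights, shows that the derivative of \<open>v\<close> enters \<open>Q\<^sub>t\<close> only through the transport
  term \<open>S Q\<^sub>z\<close>.  Integration by parts removes it, and the remaining terms converge boundedly.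
  Test functions of the affine form \<open>\<gamma>(b v + e)\<close> suffice below; \<open>\<gamma>\<close> is only required to be
  differentiable on a set that contains the values of its argument, so that \<open>1 / y\<close> is admitted.
\<close>

lemma moment_derivative:
  assumes t1: "0 < t1" "t1 \<le> \<tau>"
    and a: "\<And>t. t \<in> {0..t1} \<Longrightarrow> (a has_real_derivative a' t) (at t within {0..t1})"
    and b: "\<And>t. t \<in> {0..t1} \<Longrightarrow> (b has_real_derivative b' t) (at t within {0..t1})"
    and e: "\<And>t. t \<in> {0..t1} \<Longrightarrow> (e has_real_derivative e' t) (at t within {0..t1})"
    and cont': "continuous_on {0..t1} a'" "continuous_on {0..t1} b'" "continuous_on {0..t1} e'"
    and \<gamma>: "\<And>y. y \<in> I \<Longrightarrow> (\<gamma> has_real_derivative \<gamma>' y) (at y)"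
    and \<gamma>'_cont: "continuous_on I \<gamma>'"
    and range: "\<And>z t. z \<in> {0..H} \<Longrightarrow> t \<in> {0..t1} \<Longrightarrow> b t * v z t + e t \<in> I"
    and t: "t \<in> {0..t1}"
  shows "((\<lambda>t. integral {0..H} (\<lambda>z. a t * \<gamma> (b t * v z t + e t))) has_real_derivative
     integral {0..H} (\<lambda>z. a' t * \<gamma> (b t * v z t + e t)
       + a t * \<gamma>' (b t * v z t + e t) * (b' t * v z t + e' t + b t * ((v z t)\<^sup>2 - pressure_term t))
       + a t * \<gamma> (b t * v z t + e t) * v z t)) (at t within {0..t1})"
proof -
  define \<epsilon> where "\<epsilon> n = inverse (real (Suc (Suc n)))" for n
  have \<epsilon>: "0 < \<epsilon> n" "\<epsilon> n < 1" "\<epsilon> n \<le> 1 / 2" for n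
    by (auto simp: \<epsilon>_def field_simps)
  have \<epsilon>_lim: "\<epsilon> \<longlonglongrightarrow> 0"
    unfolding \<epsilon>_def using LIMSEQ_Suc[OF LIMSEQ_inverse_real_of_nat] .
  (* The two points stay in [0, H] for every z in [0, H], so that Q is defined on the whole interval. *)
  define lo where "lo n z = (1 - \<epsilon> n) * z" for n z
  define hi where "hi n z = (1 - \<epsilon> n) * z + \<epsilon> n * H" for n z
  have lo: "lo n z \<in> {0..H}" and hi: "hi n z \<in> {0..H}" if "z \<in> {0..H}" for n z
  proof -
    have "(1 - \<epsilon> n) * z \<le> (1 - \<epsilon> n) * H" "0 \<le> (1 - \<epsilon> n) * z" "0 \<le> \<epsilon> n * H" "\<epsilon> n * H + (1 - \<epsilon> n) * H = H"
      using that \<epsilon>[of n] H_pos by (auto intro: mult_left_mono) (simp add: algebra_simps)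
    then show "lo n z \<in> {0..H}" "hi n z \<in> {0..H}"
      unfolding lo_def hi_def by auto
  qed
  have gap: "hi n z - lo n z = \<epsilon> n * H" "lo n z < hi n z" for n z
    using \<epsilon>[of n] H_pos by (auto simp: lo_def hi_def)
  have lo_lim: "(\<lambda>n. lo n z) \<longlonglongrightarrow> z" and hi_lim: "(\<lambda>n. hi n z) \<longlonglongrightarrow> z" for z
    unfolding lo_def hi_def by (auto intro!: tendsto_eq_intros \<epsilon>_lim)
  have sub: "t \<in> {0..\<tau>}" if "t \<in> {0..t1}" for t
    using that t1 by auto

  define Q where "Q n z t = (W (hi n z) t - W (lo n z) t) / (\<epsilon> n * H)" for n z t
  define Qt where "Qt n z t = (Wt (hi n z) t - Wt (lo n z) t) / (\<epsilon> n * H)" for n z t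
  define Qz where "Qz n z t = (1 - \<epsilon> n) * (v (hi n z) t - v (lo n z) t) / (\<epsilon> n * H)" for n z t
  (* The weights make S vanish at both ends: lo n 0 = 0 and hi n H = H. *)
  define S where "S n z t = (1 - z / H) * W (lo n z) t + z / H * W (hi n z) t" for n z t
  define S' where "S' n z t = (1 - \<epsilon> n) * ((1 - z / H) * v (lo n z) t + z / H * v (hi n z) t)
      + (W (hi n z) t - W (lo n z) t) / H" for n z t
  define B where "B n z t = (1 - z / H) * v (hi n z) t + z / H * v (lo n z) t" for n z t
  (* The limit of D is v; it is what integration by parts makes of the transport term. *)
  define D where "D n z t = (1 - z / H) * v (lo n z) t + z / H * v (hi n z) t + \<epsilon> n / (1 - \<epsilon> n) * Q n z t"
    for n z t
  define Rq where "Rq n z t = (acceleration (hi n z) t - acceleration (lo n z) t) / (\<epsilon> n * H)" for n z t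
  define y where "y n z t = b t * Q n z t + e t" for n z t

  have mean: "\<exists>\<zeta>\<in>{0..H}. (f (hi n z) - f (lo n z)) / (\<epsilon> n * H) = f' \<zeta>"
    if "\<And>z. z \<in> {0..H} \<Longrightarrow> (f has_real_derivative f' z) (at z within {0..H})" and z: "z \<in> {0..H}"
    for f f' n z
  proof -
    have *: "{lo n z..hi n z} \<subseteq> {0..H}" using lo[OF z, of n] hi[OF z, of n] by auto
    have "\<exists>\<zeta>\<in>{lo n z..hi n z}. (f (hi n z) - f (lo n z)) / (hi n z - lo n z) = f' \<zeta>"
      by (rule difference_quotient_mean_value[OF gap(2)]) (use that * in \<open>blast intro: DERIV_subset\<close>)
    then show ?thesis using * by (auto simp: gap(1))
  qed
  have Q_mean: "\<exists>\<zeta>\<in>{0..H}. Q n z t = v \<zeta> t" if "z \<in> {0..H}" "t \<in> {0..t1}" for n z t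
    unfolding Q_def using mean[of "\<lambda>z. W z t" "\<lambda>z. v z t" z n] W_z that sub by blast
  have Rq_mean: "\<exists>\<zeta>\<in>{0..H}. Rq n z t = 2 * (v \<zeta> t)\<^sup>2 - pressure_term t"
    if "z \<in> {0..H}" "t \<in> {0..t1}" for n z t
    unfolding Rq_def using mean[of "\<lambda>z. acceleration z t" "\<lambda>z. 2 * (v z t)\<^sup>2 - pressure_term t" z n]
      acceleration_z that sub by blast
  have y_I: "y n z t \<in> I" if "z \<in> {0..H}" "t \<in> {0..t1}" for n z t
    using Q_mean[OF that, of n] range that by (auto simp: y_def)
  have Q_lim: "(\<lambda>n. Q n z t) \<longlonglongrightarrow> v z t" if z: "z \<in> {0..H}" and t: "t \<in> {0..t1}" for z t
  proof -
    have "(\<lambda>n. (W (hi n z) t - W (lo n z) t) / (hi n z - lo n z)) \<longlonglongrightarrow> v z t"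
      by (rule difference_quotient_tendsto[where a = 0 and b = H])
         (use z sub[OF t] W_z lo hi lo_lim hi_lim gap(2) in \<open>auto intro!: v_comp_cont continuous_intros\<close>)
    then show ?thesis by (simp add: gap(1) Q_def)
  qed
  have Rq_lim: "(\<lambda>n. Rq n z t) \<longlonglongrightarrow> 2 * (v z t)\<^sup>2 - pressure_term t"
    if z: "z \<in> {0..H}" and t: "t \<in> {0..t1}" for z t
  proof -
    have "(\<lambda>n. (acceleration (hi n z) t - acceleration (lo n z) t) / (hi n z - lo n z)) \<longlonglongrightarrow> 2 * (v z t)\<^sup>2 - pressure_term t"
      by (rule difference_quotient_tendsto[where a = 0 and b = H])
         (use z t sub[OF t] acceleration_z lo hi lo_lim hi_lim gap(2) in \<open>auto intro!: v_comp_cont continuous_intros\<close>)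
    then show ?thesis by (simp add: gap(1) Rq_def)
  qed
  have v_lim: "(\<lambda>n. v (lo n z) t) \<longlonglongrightarrow> v z t" "(\<lambda>n. v (hi n z) t) \<longlonglongrightarrow> v z t"
    if z: "z \<in> {0..H}" and t: "t \<in> {0..t1}" for z t
    by (rule continuous_on_tendsto_compose[of "{0..H}" "\<lambda>z. v z t"],
        use z sub[OF t] lo hi lo_lim hi_lim in \<open>auto intro!: v_comp_cont continuous_intros\<close>)+

  have time_cont: "continuous_on {0..t1} a" "continuous_on {0..t1} b" "continuous_on {0..t1} e"
    by (rule DERIV_continuous_on, erule a b e)+
  have \<gamma>_cont: "continuous_on I \<gamma>"
    by (rule DERIV_continuous_on, rule has_field_derivative_at_within, erule \<gamma>)
  have lohi_cont: "continuous_on A (\<lambda>s. lo n (f s))" "continuous_on A (\<lambda>s. hi n (f s))"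
    if "continuous_on A f" for A :: "'c::topological_space set" and f n
    unfolding lo_def hi_def using that by (auto intro!: continuous_intros)
  have Q_cont: "continuous_on A (\<lambda>s. Q n (f s) (g s))" and Qt_cont: "continuous_on A (\<lambda>s. Qt n (f s) (g s))"
    if "continuous_on A f" "continuous_on A g"
      and "\<And>s. s \<in> A \<Longrightarrow> f s \<in> {0..H}" "\<And>s. s \<in> A \<Longrightarrow> g s \<in> {0..t1}"
    for A :: "'c::topological_space set" and f g n
    unfolding Q_def Qt_def divide_inverse
    by (intro continuous_intros W_comp_cont Wt_comp_cont lohi_cont that lo hi sub; use that in blast)+
  have time_comp: "continuous_on A (\<lambda>s. k (g s))"
    if "continuous_on {0..t1} k" "continuous_on A g" "\<And>s. s \<in> A \<Longrightarrow> g s \<in> {0..t1}"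
    for A :: "'c::topological_space set" and k :: "real \<Rightarrow> real" and g
    by (rule continuous_on_compose2[OF that(1,2)]) (use that(3) in blast)
  have y_cont: "continuous_on A (\<lambda>s. y n (f s) (g s))"
    if "continuous_on A f" "continuous_on A g"
      and "\<And>s. s \<in> A \<Longrightarrow> f s \<in> {0..H}" "\<And>s. s \<in> A \<Longrightarrow> g s \<in> {0..t1}"
    for A :: "'c::topological_space set" and f g n
    unfolding y_def
    by (intro continuous_intros Q_cont time_comp[OF time_cont(2)] time_comp[OF time_cont(3)] that)
  have \<gamma>_comp: "continuous_on A (\<lambda>s. \<gamma> (y n (f s) (g s)))" "continuous_on A (\<lambda>s. \<gamma>' (y n (f s) (g s)))"
    if "continuous_on A f" "continuous_on A g"
      and "\<And>s. s \<in> A \<Longrightarrow> f s \<in> {0..H}" "\<And>s. s \<in> A \<Longrightarrow> g s \<in> {0..t1}"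
    for A :: "'c::topological_space set" and f g n
    using that y_I
    by (auto intro!: continuous_on_compose2[OF \<gamma>_cont y_cont[OF that]] continuous_on_compose2[OF \<gamma>'_cont y_cont[OF that]])

  define F where "F n t z = a' t * \<gamma> (y n z t)
      + a t * \<gamma>' (y n z t) * (b' t * Q n z t + b t * Qt n z t + e' t)" for n t z
  define m where "m n t z = a' t * \<gamma> (y n z t)
      + a t * \<gamma>' (y n z t) * (b' t * Q n z t + e' t + b t * (Rq n z t - Q n z t * B n z t))
      + a t * \<gamma> (y n z t) * D n z t" for n t z
  define N where "N n t = integral {0..H} (\<lambda>z. a t * \<gamma> (y n z t))" for n t

  have N_deriv: "(N n has_real_derivative integral {0..H} (F n t)) (at t within {0..t1})"
    if t: "t \<in> {0..t1}" for n t
  proof -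
    have "((\<lambda>t. integral (cbox 0 H) (\<lambda>z. a t * \<gamma> (y n z t))) has_real_derivative
        integral (cbox 0 H) (F n t)) (at t within {0..t1})"
    proof (rule leibniz_rule_field_derivative)
      fix s z assume s: "s \<in> {0..t1}" and "z \<in> cbox 0 H"
      then have z: "z \<in> {0..H}" by simp
      have Q_t: "((\<lambda>s. Q n z s) has_real_derivative Qt n z s) (at s within {0..t1})"
        unfolding Q_def Qt_def
        by (intro DERIV_cdivide DERIV_diff DERIV_subset[OF W_t] lo hi z sub s) (use t1 in auto)
      have "((\<lambda>s. y n z s) has_real_derivative b' s * Q n z s + b s * Qt n z s + e' s) (at s within {0..t1})"
        unfolding y_def by (auto intro!: derivative_eq_intros b e s Q_t)
      from DERIV_chain2[OF \<gamma>[OF y_I[OF z s]] this]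
      show "((\<lambda>s. a s * \<gamma> (y n z s)) has_real_derivative F n s z) (at s within {0..t1})"
        unfolding F_def by (auto intro!: derivative_eq_intros a s)
    next
      show "(\<lambda>z. a s * \<gamma> (y n z s)) integrable_on cbox 0 H" if "s \<in> {0..t1}" for s
        using that by (auto intro!: integrable_continuous_interval continuous_intros \<gamma>_comp)
      show "continuous_on ({0..t1} \<times> cbox 0 H) (\<lambda>(t, z). F n t z)"
        unfolding F_def case_prod_unfold
        by (intro continuous_intros \<gamma>_comp Q_cont Qt_cont time_comp[OF cont'(1)] time_comp[OF cont'(2)]
            time_comp[OF cont'(3)] time_comp[OF time_cont(1)] time_comp[OF time_cont(2)]) auto
    qed (use t in auto)
    then show ?thesis by (simp add: N_def[abs_def])
  qed
  have by_parts: "((\<lambda>z. S' n z t * \<gamma> (y n z t) + \<gamma>' (y n z t) * (b t * Qz n z t) * S n z t) has_integral 0) {0..H}"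
    if t: "t \<in> {0..t1}" for n t
  proof -
    have "((\<lambda>z. S' n z t * \<gamma> (y n z t) + \<gamma>' (y n z t) * (b t * Qz n z t) * S n z t) has_integral
        S n H t * \<gamma> (y n H t) - S n 0 t * \<gamma> (y n 0 t)) {0..H}"
    proof (rule integral_of_derivative)
      fix z assume z: "z \<in> {0..H}"
      have lo_z: "((\<lambda>z. W (lo n z) t) has_real_derivative v (lo n z) t * (1 - \<epsilon> n)) (at z within {0..H})"
        using lo by (intro DERIV_image_chain[of "\<lambda>z. W z t" _ "lo n", unfolded o_def] DERIV_subset[OF W_z[OF lo[OF z] sub[OF t]]])
          (auto simp: lo_def[abs_def] intro!: derivative_eq_intros)
      have hi_z: "((\<lambda>z. W (hi n z) t) has_real_derivative v (hi n z) t * (1 - \<epsilon> n)) (at z within {0..H})"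
        using hi by (intro DERIV_image_chain[of "\<lambda>z. W z t" _ "hi n", unfolded o_def] DERIV_subset[OF W_z[OF hi[OF z] sub[OF t]]])
          (auto simp: hi_def[abs_def] intro!: derivative_eq_intros)
      have Q_z: "((\<lambda>z. Q n z t) has_real_derivative Qz n z t) (at z within {0..H})"
        unfolding Q_def Qz_def using DERIV_cdivide[OF DERIV_diff[OF hi_z lo_z], of "\<epsilon> n * H"]
        by (simp add: algebra_simps)
      have "((\<lambda>z. y n z t) has_real_derivative b t * Qz n z t) (at z within {0..H})"
        unfolding y_def by (auto intro!: derivative_eq_intros Q_z)
      note \<gamma>_z = DERIV_chain2[OF \<gamma>[OF y_I[OF z t]] this]
      have S_z: "((\<lambda>z. S n z t) has_real_derivative S' n z t) (at z within {0..H})"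
        unfolding S_def S'_def using H_pos
        by (auto intro!: derivative_eq_intros lo_z hi_z simp: field_simps)
      show "((\<lambda>z. S n z t * \<gamma> (y n z t)) has_real_derivative
          S' n z t * \<gamma> (y n z t) + \<gamma>' (y n z t) * (b t * Qz n z t) * S n z t) (at z within {0..H})"
        by (rule DERIV_mult[OF S_z \<gamma>_z])
    qed (use H_pos in simp)
    moreover have "S n 0 t = 0" "S n H t = 0"
      using W_bottom[OF sub[OF t]] W_top[OF sub[OF t]] H_pos
      by (auto simp: S_def lo_def hi_def algebra_simps)
    ultimately show ?thesis by simp
  qed
  have m_eq: "m n t z = F n t z + a t / (1 - \<epsilon> n) *
      (S' n z t * \<gamma> (y n z t) + \<gamma>' (y n z t) * (b t * Qz n z t) * S n z t)"
    if z: "z \<in> {0..H}" and t: "t \<in> {0..t1}" for n t z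
  proof -
    have ne: "\<epsilon> n * H \<noteq> 0" "1 - \<epsilon> n \<noteq> 0" "\<epsilon> n \<noteq> 0" using \<epsilon>[of n] H_pos by auto
    have "Wt (hi n z) t - Wt (lo n z) t = (acceleration (hi n z) t - acceleration (lo n z) t)
        - (W (hi n z) t - W (lo n z) t) * B n z t - S n z t * (v (hi n z) t - v (lo n z) t)"
      unfolding Wt_eq[OF lo[OF z] sub[OF t]] Wt_eq[OF hi[OF z] sub[OF t]] B_def S_def by algebra
    moreover have "(r - q * k - s * d) / h = r / h - q / h * k - s * (d / h)" for r q k s d h :: real
      by (simp add: diff_divide_distrib)
    ultimately have "Qt n z t = Rq n z t - Q n z t * B n z t - S n z t * ((v (hi n z) t - v (lo n z) t) / (\<epsilon> n * H))"
      unfolding Qt_def Rq_def Q_def by simp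
    also have "(v (hi n z) t - v (lo n z) t) / (\<epsilon> n * H) = Qz n z t / (1 - \<epsilon> n)"
      unfolding Qz_def using ne by simp
    finally have Qt: "Qt n z t = Rq n z t - Q n z t * B n z t - S n z t * (Qz n z t / (1 - \<epsilon> n))" .
    have "(W (hi n z) t - W (lo n z) t) / H = \<epsilon> n * Q n z t"
      unfolding Q_def using ne by simp
    then have D: "S' n z t / (1 - \<epsilon> n) = D n z t"
      unfolding S'_def D_def using ne by (simp add: add_divide_distrib)
    show ?thesis
      unfolding m_def F_def Qt D[symmetric] by (simp add: algebra_simps)
  qed
  have m_int: "(m n t has_integral integral {0..H} (F n t)) {0..H}" if t: "t \<in> {0..t1}" for n t
  proof -
    have "continuous_on {0..H} (F n t)"
      unfolding F_def by (intro continuous_intros \<gamma>_comp Q_cont Qt_cont) (use t in auto)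
    then have "(F n t has_integral integral {0..H} (F n t)) {0..H}"
      by (intro integrable_integral integrable_continuous_interval)
    from has_integral_add[OF this has_integral_mult_right[OF by_parts[OF t, of n], of "a t / (1 - \<epsilon> n)"]]
    have "(m n t has_integral integral {0..H} (F n t) + a t / (1 - \<epsilon> n) * 0) {0..H}"
      by (rule has_integral_eq[rotated]) (use m_eq t in auto)
    then show ?thesis by simp
  qed

  (* Uniform boundedness as a property of families that is closed under sums and products. *)
  define ubd where "ubd f \<longleftrightarrow> (\<exists>K. \<forall>n. \<forall>z\<in>{0..H}. \<forall>t\<in>{0..t1}. \<bar>f n z t\<bar> \<le> K)"
    for f :: "nat \<Rightarrow> real \<Rightarrow> real \<Rightarrow> real"
  have ubdI: "ubd f" if "\<And>n z t. z \<in> {0..H} \<Longrightarrow> t \<in> {0..t1} \<Longrightarrow> \<bar>f n z t\<bar> \<le> K" for f K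
    unfolding ubd_def using that by blast
  have ubd_add: "ubd (\<lambda>n z t. f n z t + g n z t)" and ubd_diff: "ubd (\<lambda>n z t. f n z t - g n z t)"
    and ubd_mult: "ubd (\<lambda>n z t. f n z t * g n z t)" if fg: "ubd f" "ubd g" for f g
  proof -
    obtain K L where K: "\<And>n z t. z \<in> {0..H} \<Longrightarrow> t \<in> {0..t1} \<Longrightarrow> \<bar>f n z t\<bar> \<le> K"
      and L: "\<And>n z t. z \<in> {0..H} \<Longrightarrow> t \<in> {0..t1} \<Longrightarrow> \<bar>g n z t\<bar> \<le> L"
      using fg unfolding ubd_def by metis
    have bd: "\<bar>f n z t + g n z t\<bar> \<le> K + L" "\<bar>f n z t - g n z t\<bar> \<le> K + L" "\<bar>f n z t * g n z t\<bar> \<le> K * L"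
      if *: "z \<in> {0..H}" "t \<in> {0..t1}" for n z t
      unfolding abs_mult using K[OF *, of n] L[OF *, of n] by (linarith, linarith, intro mult_mono) auto
    show "ubd (\<lambda>n z t. f n z t + g n z t)" "ubd (\<lambda>n z t. f n z t - g n z t)"
      "ubd (\<lambda>n z t. f n z t * g n z t)"
      by (rule ubdI[OF bd(1)] ubdI[OF bd(2)] ubdI[OF bd(3)]; assumption)+
  qed
  have ubd_time: "ubd (\<lambda>n z t. k t)" if "continuous_on {0..t1} k" for k
  proof -
    have "bounded (k ` {0..t1})"
      using that by (intro compact_imp_bounded compact_continuous_image) auto
    then show ?thesis by (auto simp: bounded_iff ubd_def)
  qed
  have "continuous_on ({0..H} \<times> {0..\<tau>}) (\<lambda>(z, t). v z t)" by (rule v_cont)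
  then obtain \<Lambda> where \<Lambda>: "\<And>z t. z \<in> {0..H} \<Longrightarrow> t \<in> {0..\<tau>} \<Longrightarrow> \<bar>v z t\<bar> \<le> \<Lambda>" "0 \<le> \<Lambda>"
    using bounded_on_box by blast
  have ubd_v: "ubd (\<lambda>n z t. v (lo n z) t)" "ubd (\<lambda>n z t. v (hi n z) t)"
    by (rule ubdI[of _ \<Lambda>], rule \<Lambda>(1), erule lo hi, erule sub)+
  have ubd_Q: "ubd (\<lambda>n z t. Q n z t)"
  proof (rule ubdI)
    fix n z t assume *: "z \<in> {0..H}" "t \<in> {0..t1}"
    obtain \<zeta> where "\<zeta> \<in> {0..H}" "Q n z t = v \<zeta> t" using Q_mean[OF *] by blast
    then show "\<bar>Q n z t\<bar> \<le> \<Lambda>" using \<Lambda>(1) sub[OF *(2)] by simp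
  qed
  have "continuous_on {0..t1} pressure_term"
    by (rule continuous_on_subset[OF pressure_term_cont]) (use t1 in auto)
  then have "ubd (\<lambda>n z t. pressure_term t)" by (rule ubd_time)
  then obtain P where P: "\<And>n z t. z \<in> {0..H} \<Longrightarrow> t \<in> {0..t1} \<Longrightarrow> \<bar>pressure_term t\<bar> \<le> P"
    unfolding ubd_def by blast
  have ubd_Rq: "ubd (\<lambda>n z t. Rq n z t)"
  proof (rule ubdI)
    fix n z t assume *: "z \<in> {0..H}" "t \<in> {0..t1}"
    obtain \<zeta> where \<zeta>: "\<zeta> \<in> {0..H}" "Rq n z t = 2 * (v \<zeta> t)\<^sup>2 - pressure_term t"
      using Rq_mean[OF *] by blast
    have "(v \<zeta> t)\<^sup>2 \<le> \<Lambda>\<^sup>2"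
      using power_mono[OF \<Lambda>(1)[OF \<zeta>(1) sub[OF *(2)]] abs_ge_zero, of 2] by simp
    then show "\<bar>Rq n z t\<bar> \<le> 2 * \<Lambda>\<^sup>2 + P"
      unfolding \<zeta>(2) using P[OF *] zero_le_power2[of "v \<zeta> t"] by linarith
  qed
  have ubd_z: "ubd (\<lambda>n z t. z / H)" "ubd (\<lambda>n z t. 1 - z / H)"
    by (rule ubdI[of _ 1], use H_pos in \<open>auto simp: field_simps\<close>)+
  have ubd_\<epsilon>: "ubd (\<lambda>n z t. \<epsilon> n / (1 - \<epsilon> n))"
  proof (rule ubdI[of _ 1])
    show "\<bar>\<epsilon> n / (1 - \<epsilon> n)\<bar> \<le> 1" for n
      using \<epsilon>[of n] by (auto simp: field_simps abs_if)
  qed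
  define J where "J = (\<lambda>(z, t). b t * v z t + e t) ` ({0..H} \<times> {0..t1})"
  have "compact J"
    unfolding J_def case_prod_unfold using t1
    by (intro compact_continuous_image compact_Times compact_Icc continuous_intros v_comp_cont
        time_comp[OF time_cont(2)] time_comp[OF time_cont(3)]) auto
  have y_J: "y n z t \<in> J" if "z \<in> {0..H}" "t \<in> {0..t1}" for n z t
    using Q_mean[OF that, of n] that(2) by (force simp: J_def y_def)
  have ubd_\<gamma>: "ubd (\<lambda>n z t. k (y n z t))" if "continuous_on I k" for k
  proof -
    have "J \<subseteq> I" using range by (auto simp: J_def)
    then have "bounded (k ` J)"
      using that \<open>compact J\<close> by (intro compact_imp_bounded compact_continuous_image) (auto intro: continuous_on_subset)
    then obtain K where "\<And>y. y \<in> J \<Longrightarrow> \<bar>k y\<bar> \<le> K" by (auto simp: bounded_iff)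
    then show ?thesis using y_J by (intro ubdI[of _ K]) blast
  qed
  have "ubd (\<lambda>n z t. m n t z)"
    unfolding m_def B_def D_def
    by (intro ubd_add ubd_mult ubd_diff ubd_v ubd_Q ubd_Rq ubd_z ubd_\<epsilon> ubd_\<gamma>[OF \<gamma>_cont] ubd_\<gamma>[OF \<gamma>'_cont]
        cont'[THEN ubd_time] time_cont[THEN ubd_time])
  then obtain Km where Km: "\<And>n z t. z \<in> {0..H} \<Longrightarrow> t \<in> {0..t1} \<Longrightarrow> \<bar>m n t z\<bar> \<le> Km"
    unfolding ubd_def by blast
  have "ubd (\<lambda>n z t. a t * \<gamma> (y n z t))"
    by (intro ubd_mult ubd_\<gamma>[OF \<gamma>_cont] ubd_time[OF time_cont(1)])
  then obtain KN where KN: "\<And>n z t. z \<in> {0..H} \<Longrightarrow> t \<in> {0..t1} \<Longrightarrow> \<bar>a t * \<gamma> (y n z t)\<bar> \<le> KN"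
    unfolding ubd_def by blast

  define n0 where "n0 t = integral {0..H} (\<lambda>z. a t * \<gamma> (b t * v z t + e t))" for t
  define m0 where "m0 t z = a' t * \<gamma> (b t * v z t + e t)
      + a t * \<gamma>' (b t * v z t + e t) * (b' t * v z t + e' t + b t * ((v z t)\<^sup>2 - pressure_term t))
      + a t * \<gamma> (b t * v z t + e t) * v z t" for t z
  have \<gamma>_lim: "(\<lambda>n. k (y n z t)) \<longlonglongrightarrow> k (b t * v z t + e t)"
    if "z \<in> {0..H}" "t \<in> {0..t1}" "continuous_on I k" for k z t
    by (rule continuous_on_tendsto_compose[OF that(3)])
       (use that y_I range in \<open>auto simp: y_def intro!: tendsto_intros Q_lim\<close>)
  have N_lim: "(\<lambda>n. N n t) \<longlonglongrightarrow> n0 t" if t: "t \<in> {0..t1}" for t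
    unfolding N_def n0_def
  proof (rule bounded_convergence_interval[where K = KN])
    show "(\<lambda>z. a t * \<gamma> (y n z t)) integrable_on {0..H}" for n
      using t by (auto intro!: integrable_continuous_interval continuous_intros \<gamma>_comp)
  qed (use t KN in \<open>auto intro!: tendsto_intros \<gamma>_lim \<gamma>_cont\<close>)
  have m_lim: "(\<lambda>n. integral {0..H} (m n t)) \<longlonglongrightarrow> integral {0..H} (m0 t)" if t: "t \<in> {0..t1}" for t
  proof (rule bounded_convergence_interval[where K = Km])
    fix z assume z: "z \<in> {0..H}"
    have "(\<lambda>n. m n t z) \<longlonglongrightarrow> a' t * \<gamma> (b t * v z t + e t)
      + a t * \<gamma>' (b t * v z t + e t) * (b' t * v z t + e' t
         + b t * ((2 * (v z t)\<^sup>2 - pressure_term t) - v z t * ((1 - z / H) * v z t + z / H * v z t)))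
      + a t * \<gamma> (b t * v z t + e t) * ((1 - z / H) * v z t + z / H * v z t + 0 / (1 - 0) * v z t)"
      unfolding m_def B_def D_def
      by (intro tendsto_intros \<gamma>_lim Q_lim Rq_lim v_lim \<gamma>_cont \<gamma>'_cont z t \<epsilon>_lim) auto
    moreover have "(1 - z / H) * v z t + z / H * v z t = v z t" by (simp add: algebra_simps)
    ultimately show "(\<lambda>n. m n t z) \<longlonglongrightarrow> m0 t z"
      unfolding m0_def by (simp add: power2_eq_square)
  qed (use t Km has_integral_integrable[OF m_int[OF t]] in auto)
  have M_int: "((\<lambda>s. integral {0..H} (m n s)) has_integral N n t - N n 0) {0..t}" if t: "t \<in> {0..t1}" for n t
  proof (rule integral_of_derivative)
    fix s assume "s \<in> {0..t}"
    then have s: "s \<in> {0..t1}" using t by auto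
    have "(N n has_real_derivative integral {0..H} (m n s)) (at s within {0..t1})"
      using N_deriv[OF s, of n] integral_unique[OF m_int[OF s, of n]] by simp
    then show "(N n has_real_derivative integral {0..H} (m n s)) (at s within {0..t})"
      by (rule DERIV_subset) (use t in auto)
  qed (use t in auto)
  have "(n0 has_real_derivative integral {0..H} (m0 t)) (at t within {0..t1})"
  proof (rule has_real_derivative_of_integral_eq)
    have "continuous_on {0..t1} (\<lambda>t. integral (cbox 0 H) (m0 t))"
    proof (rule integral_continuous_on_param)
      have *: "continuous_on ({0..t1} \<times> {0..H}) (\<lambda>q. b (fst q) * v (snd q) (fst q) + e (fst q))"
        by (intro continuous_intros v_comp_cont time_comp[OF time_cont(2)] time_comp[OF time_cont(3)])
           (use t1 in auto)
      have **: "continuous_on ({0..t1} \<times> {0..H}) (\<lambda>q. k (b (fst q) * v (snd q) (fst q) + e (fst q)))"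
        if "continuous_on I k" for k :: "real \<Rightarrow> real"
        by (rule continuous_on_compose2[OF that *]) (use range in auto)
      show "continuous_on ({0..t1} \<times> cbox 0 H) (\<lambda>(t, z). m0 t z)"
        unfolding m0_def case_prod_unfold box_real
        by (intro continuous_intros ** \<gamma>_cont \<gamma>'_cont v_comp_cont time_comp[OF cont'(1)] time_comp[OF cont'(2)]
            time_comp[OF cont'(3)] time_comp[OF time_cont(1)] time_comp[OF time_cont(2)]
            continuous_on_compose2[OF pressure_term_cont])
           (use t1 in auto)
    qed
    then show "continuous_on {0..t1} (\<lambda>t. integral {0..H} (m0 t))" by simp
    fix t assume t: "t \<in> {0..t1}"
    have "(\<lambda>n. integral {0..t} (\<lambda>s. integral {0..H} (m n s))) \<longlonglongrightarrow> integral {0..t} (\<lambda>s. integral {0..H} (m0 s))"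
    proof (rule bounded_convergence_interval[where K = "Km * (H - 0)"])
      show "(\<lambda>s. integral {0..H} (m n s)) integrable_on {0..t}" for n
        using M_int[OF t] by (rule has_integral_integrable)
      fix s assume "s \<in> {0..t}"
      then have s: "s \<in> {0..t1}" using t by auto
      show "(\<lambda>n. integral {0..H} (m n s)) \<longlonglongrightarrow> integral {0..H} (m0 s)" by (rule m_lim[OF s])
      have "Km \<ge> 0" using Km[of 0 s 0] s H_pos by (auto intro: order_trans[OF abs_ge_zero])
      then have "norm (integral {0..H} (F n s)) \<le> Km * measure lborel {0..H}" for n
        by (rule has_integral_bound_real[OF _ finite.emptyI m_int[OF s]]) (use Km[OF _ s] in auto)
      then show "\<bar>integral {0..H} (m n s)\<bar> \<le> Km * (H - 0)" for n
        using integral_unique[OF m_int[OF s, of n]] H_pos by simp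
    qed
    moreover have "(\<lambda>n. integral {0..t} (\<lambda>s. integral {0..H} (m n s))) \<longlonglongrightarrow> n0 t - n0 0"
      unfolding integral_unique[OF M_int[OF t]] using t t1 by (intro tendsto_diff N_lim) auto
    ultimately show "n0 t - n0 0 = integral {0..t} (\<lambda>s. integral {0..H} (m0 s))"
      using LIMSEQ_unique by blast
  qed (use t in auto)
  then show ?thesis
    unfolding n0_def m0_def .
qed

end

section \<open>The strain at the bottom and the volume identity\<close>

lemma square_positive_part_derivative:
  "((\<lambda>y. (max 0 y)\<^sup>2) has_real_derivative 2 * max 0 y) (at (y::real))"
proof -
  consider "y < 0" | "y = 0" | "0 < y" by linarith
  then show ?thesis
  proof cases
    case 1
    have "((\<lambda>y. 0) has_real_derivative 0) (at y)" by simp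
    then have "((\<lambda>y. (max 0 y)\<^sup>2) has_real_derivative 0) (at y)"
      by (rule has_field_derivative_transform_within_open[where S = "{..<0}"]) (use 1 in auto)
    then show ?thesis using 1 by simp
  next
    case 2
    have "((\<lambda>h. (max 0 (0 + h))\<^sup>2 / h) \<longlongrightarrow> 0) (at (0::real))"
    proof (rule Lim_null_comparison)
      show "\<forall>\<^sub>F h in at (0::real). norm ((max 0 (0 + h))\<^sup>2 / h) \<le> \<bar>h\<bar>"
        by (rule always_eventually) (auto simp: power2_eq_square max_def)
    qed (auto intro!: tendsto_eq_intros)
    then show ?thesis using 2 by (simp add: DERIV_def)
  next
    case 3
    have "((\<lambda>y. y\<^sup>2) has_real_derivative 2 * y) (at y)"
      by (auto intro!: derivative_eq_intros)
    then have "((\<lambda>y. (max 0 y)\<^sup>2) has_real_derivative 2 * y) (at y)"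
      by (rule has_field_derivative_transform_within_open[where S = "{0<..}"]) (use 3 in auto)
    then show ?thesis using 3 by simp
  qed
qed

context reduced_flow
begin

text \<open>
  The bottom is a trajectory of the flow, so \<open>v\<close> satisfies the Riccati equation there.  Dividing the
  evolution law by \<open>z\<close> and letting \<open>z\<close> tend to \<open>0\<close> proves it, in integrated form in time.
\<close>

lemma bottom_strain_derivative:
  assumes t: "t \<in> {0..\<tau>}"
  shows "(v 0 has_real_derivative (v 0 t)\<^sup>2 - pressure_term t) (at t within {0..\<tau>})"
proof (rule has_real_derivative_of_integral_eq[OF _ _ t])
  show "continuous_on {0..\<tau>} (\<lambda>t. (v 0 t)\<^sup>2 - pressure_term t)"
    using H_pos by (auto intro!: continuous_intros v_comp_cont pressure_term_cont)
  fix t assume t: "t \<in> {0..\<tau>}"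
  define z where "z n = H * inverse (real (Suc n))" for n
  have z_pos: "0 < z n" and z: "z n \<in> {0..H}" for n
    using H_pos by (auto simp: z_def field_simps)
  have z_lim: "z \<longlonglongrightarrow> 0"
    unfolding z_def using tendsto_mult[OF tendsto_const LIMSEQ_inverse_real_of_nat, of H] by simp
  have W_quot: "(\<lambda>n. W (z n) s / z n) \<longlonglongrightarrow> v 0 s" if s: "s \<in> {0..\<tau>}" for s
  proof -
    have "(\<lambda>n. (W (z n) s - W 0 s) / (z n - 0)) \<longlonglongrightarrow> v 0 s"
      by (rule difference_quotient_tendsto[of 0 H])
         (use z z_pos z_lim H_pos s in \<open>auto intro!: W_z v_comp_cont continuous_intros\<close>)
    then show ?thesis by (simp add: W_bottom[OF s])
  qed
  have acc0: "acceleration 0 s = 0" for s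
    by (simp add: acceleration_def)
  have acc_quot: "(\<lambda>n. acceleration (z n) s / z n) \<longlonglongrightarrow> 2 * (v 0 s)\<^sup>2 - pressure_term s"
    if s: "s \<in> {0..\<tau>}" for s
  proof -
    have "(\<lambda>n. (acceleration (z n) s - acceleration 0 s) / (z n - 0)) \<longlonglongrightarrow> 2 * (v 0 s)\<^sup>2 - pressure_term s"
      by (rule difference_quotient_tendsto[of 0 H])
         (use z z_pos z_lim H_pos s in \<open>auto intro!: acceleration_z v_comp_cont continuous_intros\<close>)
    then show ?thesis by (simp add: acc0)
  qed
  have v_lim: "(\<lambda>n. v (z n) s) \<longlonglongrightarrow> v 0 s" if s: "s \<in> {0..\<tau>}" for s
    by (rule continuous_on_tendsto_compose[of "{0..H}" "\<lambda>z. v z s", OF _ z_lim])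
       (use z s H_pos in \<open>auto intro!: v_comp_cont continuous_intros\<close>)
  obtain \<Lambda> where \<Lambda>: "\<And>z t. z \<in> {0..H} \<Longrightarrow> t \<in> {0..\<tau>} \<Longrightarrow> \<bar>v z t\<bar> \<le> \<Lambda>" "0 \<le> \<Lambda>"
    using bounded_on_box[OF v_cont] by blast
  obtain P where P: "\<And>s. s \<in> {0..\<tau>} \<Longrightarrow> \<bar>pressure_term s\<bar> \<le> P"
    using bounded_on_interval[OF pressure_term_cont] by blast
  have Wt_int: "((\<lambda>s. Wt (z n) s / z n) has_integral W (z n) t / z n - W (z n) 0 / z n) {0..t}" for n
  proof -
    have "(Wt (z n) has_integral W (z n) t - W (z n) 0) {0..t}"
      using t z by (intro integral_of_derivative) (auto intro: DERIV_subset[OF W_t])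
    from has_integral_divide[OF this, of "z n"] show ?thesis by (simp add: diff_divide_distrib)
  qed
  have "(\<lambda>n. integral {0..t} (\<lambda>s. Wt (z n) s / z n)) \<longlonglongrightarrow> integral {0..t} (\<lambda>t. (v 0 t)\<^sup>2 - pressure_term t)"
  proof (rule bounded_convergence_interval[where K = "(2 * \<Lambda>\<^sup>2 + P) + \<Lambda> * \<Lambda>"])
    show "(\<lambda>s. Wt (z n) s / z n) integrable_on {0..t}" for n
      using Wt_int by (rule has_integral_integrable)
    fix s assume "s \<in> {0..t}"
    then have s: "s \<in> {0..\<tau>}" using t by auto
    have Wt: "Wt (z n) s / z n = acceleration (z n) s / z n - W (z n) s / z n * v (z n) s" for n
      using Wt_eq[OF z s] by (simp add: diff_divide_distrib)
    show "(\<lambda>n. Wt (z n) s / z n) \<longlonglongrightarrow> (v 0 s)\<^sup>2 - pressure_term s"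
      unfolding Wt using tendsto_diff[OF acc_quot[OF s] tendsto_mult[OF W_quot[OF s] v_lim[OF s]]]
      by (simp add: power2_eq_square)
    show "\<bar>Wt (z n) s / z n\<bar> \<le> (2 * \<Lambda>\<^sup>2 + P) + \<Lambda> * \<Lambda>" for n
    proof -
      have *: "{0..z n} \<subseteq> {0..H}" using z[of n] by auto
      have "\<exists>\<zeta>\<in>{0..z n}. (W (z n) s - W 0 s) / (z n - 0) = v \<zeta> s"
        by (rule difference_quotient_mean_value[OF z_pos]) (use * s in \<open>auto intro: DERIV_subset[OF W_z]\<close>)
      then have "\<exists>\<zeta>\<in>{0..z n}. W (z n) s / z n = v \<zeta> s" by (simp add: W_bottom[OF s])
      then obtain \<xi> where \<xi>: "\<xi> \<in> {0..H}" "W (z n) s / z n = v \<xi> s"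
        using * by blast
      have "\<exists>\<zeta>\<in>{0..z n}. (acceleration (z n) s - acceleration 0 s) / (z n - 0) = 2 * (v \<zeta> s)\<^sup>2 - pressure_term s"
        by (rule difference_quotient_mean_value[OF z_pos]) (use * s in \<open>auto intro: DERIV_subset[OF acceleration_z]\<close>)
      then have "\<exists>\<zeta>\<in>{0..z n}. acceleration (z n) s / z n = 2 * (v \<zeta> s)\<^sup>2 - pressure_term s"
        by (simp add: acc0)
      then obtain \<zeta> where \<zeta>: "\<zeta> \<in> {0..H}" "acceleration (z n) s / z n = 2 * (v \<zeta> s)\<^sup>2 - pressure_term s"
        using * by blast
      have "(v \<zeta> s)\<^sup>2 \<le> \<Lambda>\<^sup>2"
        using power_mono[OF \<Lambda>(1)[OF \<zeta>(1) s] abs_ge_zero, of 2] by simp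
      then have "\<bar>acceleration (z n) s / z n\<bar> \<le> 2 * \<Lambda>\<^sup>2 + P"
        unfolding \<zeta>(2) using P[OF s] zero_le_power2[of "v \<zeta> s"] by linarith
      moreover have "\<bar>W (z n) s / z n * v (z n) s\<bar> \<le> \<Lambda> * \<Lambda>"
        unfolding \<xi>(2) abs_mult by (intro mult_mono \<Lambda> \<xi> z s) auto
      ultimately show ?thesis unfolding Wt by linarith
    qed
  qed
  moreover have "(\<lambda>n. integral {0..t} (\<lambda>s. Wt (z n) s / z n)) \<longlonglongrightarrow> v 0 t - v 0 0"
    unfolding integral_unique[OF Wt_int] using t \<tau>_pos by (intro tendsto_diff W_quot) auto
  ultimately show "v 0 t - v 0 0 = integral {0..t} (\<lambda>t. (v 0 t)\<^sup>2 - pressure_term t)"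
    using LIMSEQ_unique by blast
qed

text \<open>
  A maximum principle along trajectories that are never constructed: both \<open>v\<close> and \<open>V\<close> solve the
  Riccati equation with the same pressure term, so by the moment identity the integral of the
  square of the positive part of \<open>v - V\<close> grows at most exponentially, and it vanishes initially.
\<close>

lemma strain_le_Riccati_solution:
  assumes t1: "0 < t1" "t1 \<le> \<tau>"
    and V: "\<And>t. t \<in> {0..t1} \<Longrightarrow> (V has_real_derivative (V t)\<^sup>2 - pressure_term t) (at t within {0..t1})"
    and init: "\<And>z. z \<in> {0..H} \<Longrightarrow> v z 0 \<le> V 0"
    and t: "t \<in> {0..t1}" and z: "z \<in> {0..H}"
  shows "v z t \<le> V t"
proof -
  have V_cont: "continuous_on {0..t1} V"
    by (rule DERIV_continuous_on, erule V)
  have p_cont: "continuous_on {0..t1} pressure_term"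
    by (rule continuous_on_subset[OF pressure_term_cont]) (use t1 in auto)
  obtain \<Lambda> where \<Lambda>: "\<And>z t. z \<in> {0..H} \<Longrightarrow> t \<in> {0..\<tau>} \<Longrightarrow> \<bar>v z t\<bar> \<le> \<Lambda>" "0 \<le> \<Lambda>"
    using bounded_on_box[OF v_cont] by blast
  obtain K where K: "\<And>s. s \<in> {0..t1} \<Longrightarrow> \<bar>V s\<bar> \<le> K"
    using bounded_on_interval[OF V_cont] by blast
  (* A rate that dominates 3 v + 2 V, the logarithmic growth rate of the moment. *)
  define \<mu> where "\<mu> = 3 * \<Lambda> + 2 * K"
  define N where "N s = integral {0..H} (\<lambda>z. exp (- \<mu> * s) * (max 0 (1 * v z s + - V s))\<^sup>2)" for s
  define M where "M s z = (- \<mu> * exp (- \<mu> * s)) * (max 0 (1 * v z s + - V s))\<^sup>2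
      + exp (- \<mu> * s) * (2 * max 0 (1 * v z s + - V s))
        * (0 * v z s + - ((V s)\<^sup>2 - pressure_term s) + 1 * ((v z s)\<^sup>2 - pressure_term s))
      + exp (- \<mu> * s) * (max 0 (1 * v z s + - V s))\<^sup>2 * v z s" for s z
  have N_deriv: "(N has_real_derivative integral {0..H} (M s)) (at s within {0..t1})"
    if s: "s \<in> {0..t1}" for s
    unfolding N_def[abs_def] M_def[abs_def]
  proof (rule moment_derivative[OF t1, where I = UNIV and \<gamma>' = "\<lambda>y. 2 * max 0 y"])
    show "((\<lambda>s. exp (- \<mu> * s)) has_real_derivative - \<mu> * exp (- \<mu> * s)) (at s within {0..t1})" for s
      by (auto intro!: derivative_eq_intros)
    show "((\<lambda>s. - V s) has_real_derivative - ((V s)\<^sup>2 - pressure_term s)) (at s within {0..t1})"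
      if "s \<in> {0..t1}" for s
      using V[OF that] by (rule DERIV_minus)
  qed (use s in \<open>auto intro!: continuous_intros V_cont p_cont square_positive_part_derivative\<close>)
  have M_nonpos: "M s z \<le> 0" if s: "s \<in> {0..t1}" and z: "z \<in> {0..H}" for s z
  proof -
    define X where "X = max 0 (v z s - V s)"
    have "X * (v z s - V s) = X\<^sup>2"
      by (auto simp: X_def max_def power2_eq_square)
    moreover have "X * ((v z s)\<^sup>2 - (V s)\<^sup>2) = X * (v z s - V s) * (v z s + V s)"
      by (simp add: power2_eq_square algebra_simps)
    ultimately have "X * ((v z s)\<^sup>2 - (V s)\<^sup>2) = X\<^sup>2 * (v z s + V s)" by simp
    then have "M s z = exp (- \<mu> * s) * (X\<^sup>2 * (3 * v z s + 2 * V s - \<mu>))"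
      unfolding M_def X_def by (simp add: algebra_simps)
    moreover have "3 * v z s + 2 * V s - \<mu> \<le> 0"
      using \<Lambda>(1)[OF z, of s] K[OF s] s t1 by (auto simp: \<mu>_def abs_le_iff)
    ultimately show ?thesis
      by (simp add: mult_le_0_iff)
  qed
  have N_cont: "continuous_on {0..t1} N"
    by (rule DERIV_continuous_on, erule N_deriv)
  have "N t \<le> N 0"
  proof (rule DERIV_nonpos_imp_decreasing_open[where f = N and a = 0 and b = t])
    show "continuous_on {0..t} N"
      using N_cont by (rule continuous_on_subset) (use t in auto)
    fix s assume "0 < s" "s < t"
    then have s: "s \<in> {0..t1}" "0 < s" "s < t1" using t by auto
    have "integral {0..H} (M s) \<le> 0"
    proof (cases "M s integrable_on {0..H}")
      case True
      have "integral {0..H} (M s) \<le> integral {0..H} (\<lambda>_. 0 :: real)"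
        by (rule integral_le) (use True M_nonpos s in auto)
      then show ?thesis by simp
    qed (simp add: not_integrable_integral)
    then show "\<exists>y. DERIV N s :> y \<and> y \<le> 0"
      using N_deriv[OF s(1)] s by (auto simp: at_within_Icc_at)
  qed (use t in auto)
  also have "N 0 = 0"
    unfolding N_def by (rule integral_unique, rule has_integral_is_0) (use init in auto)
  finally have "N t \<le> 0" .
  have int_cont: "continuous_on {0..H} (\<lambda>z. exp (- \<mu> * t) * (max 0 (1 * v z t + - V t))\<^sup>2)"
    using t t1 by (auto intro!: continuous_intros v_comp_cont)
  then have "0 \<le> N t"
    unfolding N_def by (intro integral_nonneg integrable_continuous_interval) auto
  with \<open>N t \<le> 0\<close> have "N t = 0" by simp
  then have "exp (- \<mu> * t) * (max 0 (1 * v z t + - V t))\<^sup>2 = 0"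
    using integral_eq_0_iff[OF int_cont H_pos] z unfolding N_def by auto
  then show ?thesis by (auto simp: max_def split: if_splits)
qed

text \<open>
  The Riccati equation \<open>v' = v\<^sup>2 - c\<close> is linearised by \<open>v = - y' / y\<close> with \<open>y'' = c y\<close>.  The solution
  \<open>V\<close> provides \<open>y = 1 / J\<close>, and \<open>\<eta> / J\<close> is a second solution by reduction of order.  Hence a
  trajectory with initial strain \<open>s\<close> has \<open>y = (1 + (V 0 - s) \<eta>) / J\<close>, and \<open>1 / y\<close> is the factor by
  which it stretches vertical lengths.  The identity says that the stretched interval still has
  length \<open>H\<close>.

  In Eulerian terms, the test function is the ratio \<open>y t / y t1\<close> expressed through the strain at
  time \<open>t\<close> and divided by \<open>J t1\<close>.  Its moment is conserved; it is \<open>H / J t1\<close> at time \<open>t1\<close> and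
  the integral in the statement at time \<open>0\<close>.
  The number \<open>\<delta>\<close> bounds the excess of the initial strain over \<open>V 0\<close>, and \<open>1 - \<delta> * \<eta> t1 > 0\<close>
  ensures that no trajectory has reached a zero of \<open>y\<close>.
\<close>

lemma lagrangian_volume:
  assumes t1: "0 < t1" "t1 \<le> \<tau>"
    and V: "\<And>t. t \<in> {0..t1} \<Longrightarrow> (V has_real_derivative (V t)\<^sup>2 - pressure_term t) (at t within {0..t1})"
    and J: "\<And>t. t \<in> {0..t1} \<Longrightarrow> (J has_real_derivative V t * J t) (at t within {0..t1})"
    and \<eta>: "\<And>t. t \<in> {0..t1} \<Longrightarrow> (\<eta> has_real_derivative (J t)\<^sup>2) (at t within {0..t1})"
    and J_pos: "\<And>t. t \<in> {0..t1} \<Longrightarrow> 0 < J t"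
    and init: "J 0 = 1" "\<eta> 0 = 0" "0 \<le> \<delta>" "\<And>z. z \<in> {0..H} \<Longrightarrow> v z 0 \<le> V 0 + \<delta>"
    and admissible: "0 < 1 - \<delta> * \<eta> t1"
  shows "J t1 * integral {0..H} (\<lambda>z. 1 / (1 + (V 0 - v z 0) * \<eta> t1)) = H"
proof -
  have \<eta>_le: "\<eta> t \<le> \<eta> t1" if t: "t \<in> {0..t1}" for t
  proof -
    have "((\<lambda>s. (J s)\<^sup>2) has_integral \<eta> t1 - \<eta> t) {t..t1}"
      using t by (intro integral_of_derivative) (auto intro: DERIV_subset[OF \<eta>])
    from has_integral_nonneg[OF this] show ?thesis by simp
  qed
  have pos: "0 < 1 - \<delta> * \<eta> t" if t: "t \<in> {0..t1}" for t
    using mult_left_mono[OF \<eta>_le[OF t] \<open>0 \<le> \<delta>\<close>] admissible by linarith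
  (* The Riccati solution with U 0 = V 0 + \<delta>; it dominates v and keeps the denominators positive. *)
  define U where "U t = V t + \<delta> * (J t)\<^sup>2 / (1 - \<delta> * \<eta> t)" for t
  have U_deriv: "(U has_real_derivative (U t)\<^sup>2 - pressure_term t) (at t within {0..t1})" if t: "t \<in> {0..t1}" for t
  proof -
    define q where "q = 1 - \<delta> * \<eta> t"
    have "q \<noteq> 0" using pos[OF t] by (simp add: q_def)
    have "(U has_real_derivative ((V t)\<^sup>2 - pressure_term t) +
        (\<delta> * (2 * J t * (V t * J t)) * q + \<delta> * (J t)\<^sup>2 * (\<delta> * (J t)\<^sup>2)) / (q * q)) (at t within {0..t1})"
      unfolding U_def[abs_def] q_def using pos[OF t]
      by (auto intro!: derivative_eq_intros V[OF t] J[OF t] \<eta>[OF t])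
    also have "((V t)\<^sup>2 - pressure_term t) +
        (\<delta> * (2 * J t * (V t * J t)) * q + \<delta> * (J t)\<^sup>2 * (\<delta> * (J t)\<^sup>2)) / (q * q) = (U t)\<^sup>2 - pressure_term t"
      unfolding U_def q_def[symmetric] using \<open>q \<noteq> 0\<close> by (simp add: field_simps power2_eq_square)
    finally show ?thesis .
  qed
  have v_le_U: "v z t \<le> U t" if "z \<in> {0..H}" "t \<in> {0..t1}" for z t
    by (rule strain_le_Riccati_solution[OF t1 U_deriv _ that(2,1)]) (use init in \<open>auto simp: U_def\<close>)

  define a where "a t = 1 / J t" for t
  define b where "b t = - (\<eta> t1 - \<eta> t) / (J t)\<^sup>2" for t
  define e where "e t = 1 - V t * b t" for t
  have a': "(a has_real_derivative - V t * a t) (at t within {0..t1})" if t: "t \<in> {0..t1}" for t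
    unfolding a_def using J_pos[OF t] by (auto intro!: derivative_eq_intros J[OF t] simp: field_simps)
  have b': "(b has_real_derivative 1 - 2 * V t * b t) (at t within {0..t1})" if t: "t \<in> {0..t1}" for t
    unfolding b_def using J_pos[OF t]
    by (auto intro!: derivative_eq_intros J[OF t] \<eta>[OF t] simp: field_simps power2_eq_square)
  have e': "(e has_real_derivative - (((V t)\<^sup>2 - pressure_term t) * b t + (1 - 2 * V t * b t) * V t)) (at t within {0..t1})"
    if t: "t \<in> {0..t1}" for t
    unfolding e_def by (auto intro!: derivative_eq_intros V[OF t] b'[OF t])
  have b_nonpos: "b t \<le> 0" if t: "t \<in> {0..t1}" for t
    unfolding b_def using \<eta>_le[OF t] by (simp add: divide_nonpos_nonneg)
  have D_pos: "0 < b t * v z t + e t" if z: "z \<in> {0..H}" and t: "t \<in> {0..t1}" for z t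
  proof -
    have "b t * (U t - V t) \<le> b t * (v z t - V t)"
      using v_le_U[OF z t] b_nonpos[OF t] by (intro mult_left_mono_neg) auto
    moreover have "1 + b t * (U t - V t) = (1 - \<delta> * \<eta> t1) / (1 - \<delta> * \<eta> t)"
      unfolding U_def b_def using pos[OF t] J_pos[OF t] by (simp add: field_simps)
    moreover have "0 < (1 - \<delta> * \<eta> t1) / (1 - \<delta> * \<eta> t)"
      using pos[OF t] admissible by simp
    moreover have "b t * v z t + e t = 1 + b t * (v z t - V t)"
      unfolding e_def by (simp add: algebra_simps)
    ultimately show ?thesis by linarith
  qed
  have cont: "continuous_on {0..t1} V" "continuous_on {0..t1} a" "continuous_on {0..t1} b"
    by (rule DERIV_continuous_on, erule V a' b')+
  have p_cont: "continuous_on {0..t1} pressure_term"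
    by (rule continuous_on_subset[OF pressure_term_cont]) (use t1 in auto)
  define N where "N t = integral {0..H} (\<lambda>z. a t * (1 / (b t * v z t + e t)))" for t
  have N_deriv: "(N has_real_derivative 0) (at t within {0..t1})" if t: "t \<in> {0..t1}" for t
  proof -
    define M where "M z = (- V t * a t) * (1 / (b t * v z t + e t))
       + a t * (- 1 / (b t * v z t + e t)\<^sup>2) * ((1 - 2 * V t * b t) * v z t
          + - (((V t)\<^sup>2 - pressure_term t) * b t + (1 - 2 * V t * b t) * V t)
          + b t * ((v z t)\<^sup>2 - pressure_term t))
       + a t * (1 / (b t * v z t + e t)) * v z t" for z
    have "(N has_real_derivative integral {0..H} M) (at t within {0..t1})"
      unfolding N_def[abs_def] M_def[abs_def]
    proof (rule moment_derivative[OF t1 a' b' e', where I = "{0<..}"])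
      show "((\<lambda>y. 1 / y) has_real_derivative - 1 / y\<^sup>2) (at y)" if "y \<in> {0<..}" for y :: real
        using that by (auto intro!: derivative_eq_intros simp: power2_eq_square)
      show "continuous_on {0<..} (\<lambda>y. - 1 / y\<^sup>2 :: real)"
        by (auto intro!: continuous_intros)
    qed (use t D_pos in \<open>auto intro!: continuous_intros cont p_cont\<close>)
    moreover have "M z = 0" if z: "z \<in> {0..H}" for z
    proof -
      define D where "D = b t * v z t + e t"
      have D: "D = 1 + b t * (v z t - V t)" "D \<noteq> 0"
        using D_pos[OF z t] by (auto simp: D_def e_def algebra_simps)
      have flux: "(1 - 2 * V t * b t) * v z t + - (((V t)\<^sup>2 - pressure_term t) * b t + (1 - 2 * V t * b t) * V t)
          + b t * ((v z t)\<^sup>2 - pressure_term t) = (v z t - V t) * D"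
        unfolding D(1) by algebra
      show ?thesis
        unfolding M_def D_def[symmetric] flux using D(2) by (simp add: field_simps power2_eq_square)
    qed
    then have "integral {0..H} M = 0"
      by (intro integral_unique has_integral_is_0)
    ultimately show ?thesis by simp
  qed
  obtain k where k: "\<forall>t\<in>{0..t1}. N t = k"
    using has_field_derivative_zero_constant[OF convex_real_interval(5) N_deriv] by blast
  then have "N t1 = N 0" using t1 by auto
  moreover have "N t1 = H / J t1"
    unfolding N_def a_def e_def b_def using H_pos by simp
  moreover have "N 0 = integral {0..H} (\<lambda>z. 1 / (1 + (V 0 - v z 0) * \<eta> t1))"
    unfolding N_def a_def e_def b_def using init by (simp add: algebra_simps)
  ultimately show ?thesis
    using J_pos[of t1] t1 by (simp add: field_simps)
qed

end

section \<open>The profile\<close>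

text \<open>
  The profile equation with its integral term abbreviated to the constant \<open>C\<close>.  A zero of \<open>\<phi>\<close> has
  a slope \<open>s\<close> with \<open>s\<^sup>2 - s = C\<close>, that is, \<open>s\<close> is \<open>max_slope\<close> or \<open>1 - max_slope\<close>.
\<close>

locale profile =
  fixes H :: real and \<phi> \<phi>' \<phi>'' :: "real \<Rightarrow> real" and C :: real
  assumes H_pos: "0 < H"
    and \<phi>_deriv: "\<And>z. z \<in> {0..H} \<Longrightarrow> (\<phi> has_real_derivative \<phi>' z) (at z within {0..H})"
    and \<phi>'_deriv: "\<And>z. z \<in> {0..H} \<Longrightarrow> (\<phi>' has_real_derivative \<phi>'' z) (at z within {0..H})"
    and ode: "\<And>z. z \<in> {0..H} \<Longrightarrow> \<phi> z * \<phi>'' z = (\<phi>' z)\<^sup>2 - \<phi>' z - C"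
    and boundary: "\<phi> 0 = 0" "\<phi> H = 0"
    and C_pos: "0 < C"
begin

definition max_slope :: real where
  "max_slope = (1 + sqrt (1 + 4 * C)) / 2"

lemma max_slope: "1 < max_slope" "max_slope\<^sup>2 - max_slope = C"
proof -
  have "1 < sqrt (1 + 4 * C)" using C_pos by simp
  then show "1 < max_slope" by (simp add: max_slope_def)
  have "(sqrt (1 + 4 * C))\<^sup>2 = 1 + 4 * C" using C_pos by simp
  then show "max_slope\<^sup>2 - max_slope = C"
    unfolding max_slope_def by (simp add: power2_eq_square field_simps)
qed

lemma root_cases:
  assumes "s\<^sup>2 - s - C = 0"
  shows "s = max_slope \<or> s = 1 - max_slope"
proof -
  have "(s - max_slope) * (s - (1 - max_slope)) = s\<^sup>2 - s - (max_slope\<^sup>2 - max_slope)"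
    by (simp add: power2_eq_square algebra_simps)
  then have "(s - max_slope) * (s - (1 - max_slope)) = 0"
    using assms max_slope(2) by simp
  then show ?thesis by auto
qed

lemma slope_at_zero: "z \<in> {0..H} \<Longrightarrow> \<phi> z = 0 \<Longrightarrow> \<phi>' z = max_slope \<or> \<phi>' z = 1 - max_slope"
  using ode[of z] by (intro root_cases) simp

lemma slope_cont: "continuous_on {0..H} \<phi>'"
  by (rule DERIV_continuous_on, erule \<phi>'_deriv)

text \<open>
  Where \<open>\<phi>'\<close> is largest, \<open>\<phi> \<phi>''\<close> vanishes: in the interior because \<open>\<phi>'' = 0\<close>, at the ends because
  \<open>\<phi> = 0\<close>.  So the maximal slope solves the same quadratic equation.
\<close>

lemma slope_le_max_slope:
  assumes "z \<in> {0..H}"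
  shows "\<phi>' z \<le> max_slope"
proof -
  obtain y where y: "y \<in> {0..H}" "\<And>z. z \<in> {0..H} \<Longrightarrow> \<phi>' z \<le> \<phi>' y"
    using continuous_attains_sup[OF compact_Icc _ slope_cont] H_pos by auto
  have "\<phi> y * \<phi>'' y = 0"
  proof (cases "y = 0 \<or> y = H")
    case False
    then have "0 < y" "y < H" using y(1) by auto
    then have "DERIV \<phi>' y :> \<phi>'' y"
      using \<phi>'_deriv[OF y(1)] by (simp add: at_within_Icc_at)
    then have "\<phi>'' y = 0"
      by (rule DERIV_local_max[where d = "min y (H - y)"])
         (use \<open>0 < y\<close> \<open>y < H\<close> y(2) in \<open>auto simp: abs_if split: if_splits\<close>)
    then show ?thesis by simp
  qed (use boundary in auto)
  then have "\<phi>' y = max_slope \<or> \<phi>' y = 1 - max_slope"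
    using ode[OF y(1)] by (intro root_cases) simp
  then show ?thesis
    using y(2)[OF assms] max_slope(1) by auto
qed

text \<open>
  The derivative of \<open>\<phi> / (1 + (\<sigma> - \<phi>') \<eta>)\<close> integrates to zero, and the profile equation, with right
  side \<open>(\<phi>' - \<sigma>) (\<phi>' + \<sigma> - 1)\<close>, expresses it through \<open>\<phi>'\<close> alone.  The right integral is minus the
  derivative of the left one with respect to \<open>\<eta>\<close>, so this is a linear differential equation for
  the left integral.
\<close>

lemma slope_moments:
  assumes \<sigma>: "\<sigma>\<^sup>2 - \<sigma> = C"
    and pos: "\<And>z. z \<in> {0..H} \<Longrightarrow> 0 < 1 + (\<sigma> - \<phi>' z) * \<eta>"
  shows "\<sigma> * integral {0..H} (\<lambda>z. 1 / (1 + (\<sigma> - \<phi>' z) * \<eta>)) =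
    (1 + (2 * \<sigma> - 1) * \<eta>) * integral {0..H} (\<lambda>z. (\<sigma> - \<phi>' z) / (1 + (\<sigma> - \<phi>' z) * \<eta>)\<^sup>2)"
proof -
  define g where "g z = 1 + (\<sigma> - \<phi>' z) * \<eta>" for z
  have g: "g z \<noteq> 0" if "z \<in> {0..H}" for z
    using pos[OF that] by (simp add: g_def)
  have g_cont: "continuous_on {0..H} g"
    unfolding g_def by (intro continuous_intros slope_cont)
  have "((\<lambda>z. \<sigma> * (1 / g z) - (1 + (2 * \<sigma> - 1) * \<eta>) * ((\<sigma> - \<phi>' z) / (g z)\<^sup>2)) has_integral
      \<phi> H / g H - \<phi> 0 / g 0) {0..H}"
  proof (rule integral_of_derivative)
    fix z assume z: "z \<in> {0..H}"
    have "(g has_real_derivative - \<phi>'' z * \<eta>) (at z within {0..H})"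
      unfolding g_def[abs_def] by (auto intro!: derivative_eq_intros \<phi>'_deriv z)
    from DERIV_divide[OF \<phi>_deriv[OF z] this g[OF z]]
    have "((\<lambda>z. \<phi> z / g z) has_real_derivative (\<phi>' z * g z + (\<phi> z * \<phi>'' z) * \<eta>) / (g z)\<^sup>2) (at z within {0..H})"
      by (simp add: power2_eq_square algebra_simps)
    also have "\<phi>' z * g z + (\<phi> z * \<phi>'' z) * \<eta> = \<sigma> * g z - (1 + (2 * \<sigma> - 1) * \<eta>) * (\<sigma> - \<phi>' z)"
      unfolding ode[OF z] g_def \<sigma>[symmetric] by algebra
    also have "(\<sigma> * g z - (1 + (2 * \<sigma> - 1) * \<eta>) * (\<sigma> - \<phi>' z)) / (g z)\<^sup>2 =
        \<sigma> * (1 / g z) - (1 + (2 * \<sigma> - 1) * \<eta>) * ((\<sigma> - \<phi>' z) / (g z)\<^sup>2)"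
    proof -
      have "(s * h - a * d) / h\<^sup>2 = s * (1 / h) - a * (d / h\<^sup>2)" if "h \<noteq> 0" for s h a d :: real
        using that by (simp add: field_simps power2_eq_square)
      then show ?thesis using g[OF z] by blast
    qed
    finally show "((\<lambda>z. \<phi> z / g z) has_real_derivative
        \<sigma> * (1 / g z) - (1 + (2 * \<sigma> - 1) * \<eta>) * ((\<sigma> - \<phi>' z) / (g z)\<^sup>2)) (at z within {0..H})" .
  qed (use H_pos in simp)
  then have zero: "((\<lambda>z. \<sigma> * (1 / g z) - (1 + (2 * \<sigma> - 1) * \<eta>) * ((\<sigma> - \<phi>' z) / (g z)\<^sup>2)) has_integral 0) {0..H}"
    using boundary by simp
  have "((\<lambda>z. \<sigma> * (1 / g z) - (1 + (2 * \<sigma> - 1) * \<eta>) * ((\<sigma> - \<phi>' z) / (g z)\<^sup>2)) has_integral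
      \<sigma> * integral {0..H} (\<lambda>z. 1 / g z)
      - (1 + (2 * \<sigma> - 1) * \<eta>) * integral {0..H} (\<lambda>z. (\<sigma> - \<phi>' z) / (g z)\<^sup>2)) {0..H}"
    by (intro has_integral_diff has_integral_mult_right integrable_integral integrable_continuous_interval
        continuous_intros g_cont slope_cont) (use g in auto)
  from has_integral_unique[OF zero this] show ?thesis
    unfolding g_def[symmetric] by simp
qed

end

text \<open>
  A vanishing integral term would force \<open>\<phi>' = 0\<close> and thus \<open>\<phi> = 0\<close>; hence \<open>C > 0\<close> for nontrivial \<open>\<phi>\<close>.
\<close>

lemma profile_solution_profile:
  assumes "0 < H" "profile_solution H \<phi>" "\<exists>z\<in>{0..H}. \<phi> z \<noteq> 0"
  shows "profile H \<phi> (zderiv H \<phi>) (zderiv H (zderiv H \<phi>))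
    (2 / H * integral {0..H} (\<lambda>s. (zderiv H \<phi> s)\<^sup>2))"
proof -
  define C where "C = 2 / H * integral {0..H} (\<lambda>s. (zderiv H \<phi> s)\<^sup>2)"
  have zderiv: "(f has_real_derivative zderiv H f z) (at z within {0..H})"
    if "f differentiable_on {0..H}" "z \<in> {0..H}" for f z
    using that vector_derivative_works[of f "at z within {0..H}"]
    by (auto simp: differentiable_on_def zderiv_def has_real_derivative_iff_has_vector_derivative)
  have d: "\<phi> differentiable_on {0..H}" "zderiv H \<phi> differentiable_on {0..H}"
    and ode: "\<And>z. z \<in> {0..H} \<Longrightarrow> zderiv H \<phi> z - (zderiv H \<phi> z)\<^sup>2 + \<phi> z * zderiv H (zderiv H \<phi>) z + C = 0"
    and bd: "\<phi> 0 = 0" "\<phi> H = 0"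
    using assms(2) by (auto simp: profile_solution_def C_def)
  have cont: "continuous_on {0..H} (\<lambda>s. (zderiv H \<phi> s)\<^sup>2)"
    by (intro continuous_intros differentiable_imp_continuous_on d)
  have "integral {0..H} (\<lambda>s. (zderiv H \<phi> s)\<^sup>2) \<noteq> 0"
  proof
    assume "integral {0..H} (\<lambda>s. (zderiv H \<phi> s)\<^sup>2) = 0"
    then have *: "zderiv H \<phi> z = 0" if "z \<in> {0..H}" for z
      using integral_eq_0_iff[OF cont \<open>0 < H\<close>] that by simp
    have "\<exists>k. \<forall>z\<in>{0..H}. \<phi> z = k"
      by (rule has_field_derivative_zero_constant) (use zderiv[OF d(1)] * in fastforce)+
    then show False using bd assms(1,3) by fastforce
  qed
  moreover have "0 \<le> integral {0..H} (\<lambda>s. (zderiv H \<phi> s)\<^sup>2)"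
    by (intro integral_nonneg integrable_continuous_interval cont) auto
  ultimately have "0 < C" using \<open>0 < H\<close> by (simp add: C_def)
  then show ?thesis
    unfolding C_def[symmetric]
    using zderiv d ode bd assms(1) by unfold_locales (auto simp: algebra_simps)
qed

section \<open>Breakdown\<close>

text \<open>
  The lemma combines the volume identity \<open>J \<integral> 1 / (1 + (\<sigma> - \<phi>') \<eta>) = H\<close> with the linear equation for
  the integral in it.  Differentiating in time and eliminating the integrals leaves
  \<open>V P = \<sigma> J\<^sup>2\<close> with \<open>P = 1 + (2 \<sigma> - 1) \<eta>\<close>, whence \<open>(P / J\<^sup>2)' = - 1\<close> and \<open>P = (1 - t) J\<^sup>2\<close>, so that
  \<open>V = \<sigma> / (1 - t)\<close> as for the self-similar flow \<open>\<phi> / (1 - t)\<close>.  At \<open>t = 1\<close> this contradicts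
  \<open>V P = \<sigma> J\<^sup>2 \<noteq> 0\<close>.

  The slope \<open>\<sigma>\<close> at the bottom may be either root of \<open>s\<^sup>2 - s = C\<close>.  If it is the larger one, then
  \<open>\<delta> = 0\<close> and the volume identity is available up to \<open>t = 1\<close>.  Otherwise \<open>1 - \<delta> \<eta> = P\<close>, and at the
  first zero of \<open>P\<close> the relation \<open>V P = \<sigma> J\<^sup>2\<close> would fail, so there is no zero.
\<close>

lemma no_unit_time_flow:
  assumes "reduced_flow H 1 W v Wt" and "profile H \<phi> \<phi>' \<phi>'' C"
    and init: "\<And>z. z \<in> {0..H} \<Longrightarrow> v z 0 = \<phi>' z"
  shows False
proof -
  interpret reduced_flow H 1 W v Wt by fact
  interpret P: profile H \<phi> \<phi>' \<phi>'' C by fact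
  define m where "m = P.max_slope"
  define \<sigma> where "\<sigma> = \<phi>' 0"
  define \<delta> where "\<delta> = m - \<sigma>"
  have m: "1 < m" "m\<^sup>2 - m = C"
    using P.max_slope by (simp_all add: m_def)
  have \<sigma>_cases: "\<sigma> = m \<or> \<sigma> = 1 - m"
    using P.slope_at_zero[of 0] P.boundary H_pos by (simp add: \<sigma>_def m_def)
  have "(1 - m)\<^sup>2 - (1 - m) = m\<^sup>2 - m" by algebra
  then have \<sigma>: "\<sigma>\<^sup>2 - \<sigma> = C" "\<sigma> \<noteq> 0" "0 \<le> \<delta>" "\<delta> = 0 \<or> \<delta> = - (2 * \<sigma> - 1)"
    using \<sigma>_cases m by (auto simp: \<delta>_def)

  define V where "V = v 0"
  have V: "(V has_real_derivative (V t)\<^sup>2 - pressure_term t) (at t within {0..1})" if "t \<in> {0..1}" for t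
    unfolding V_def by (rule bottom_strain_derivative[OF that])
  have V_cont: "continuous_on {0..1} V"
    by (rule DERIV_continuous_on, erule V)
  have V0: "V 0 = \<sigma>" using init[of 0] H_pos by (simp add: V_def \<sigma>_def)
  define J where "J t = exp (integral {0..t} V)" for t
  have J: "(J has_real_derivative V t * J t) (at t within {0..1})" if t: "t \<in> {0..1}" for t
    unfolding J_def[abs_def] using integral_has_real_derivative[OF V_cont t]
    by (auto intro!: derivative_eq_intros)
  have J_pos: "0 < J t" for t by (simp add: J_def)
  have J_cont: "continuous_on {0..1} J"
    by (rule DERIV_continuous_on, erule J)
  define \<eta> where "\<eta> t = integral {0..t} (\<lambda>s. (J s)\<^sup>2)" for t
  have \<eta>: "(\<eta> has_real_derivative (J t)\<^sup>2) (at t within {0..1})" if t: "t \<in> {0..1}" for t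
    unfolding \<eta>_def[abs_def] by (intro integral_has_real_derivative continuous_intros J_cont t)
  have \<eta>_cont: "continuous_on {0..1} \<eta>"
    by (rule DERIV_continuous_on, erule \<eta>)
  have J0: "J 0 = 1" and \<eta>0: "\<eta> 0 = 0" by (simp_all add: J_def \<eta>_def)
  have \<eta>_less: "\<eta> s < \<eta> t" if "s \<in> {0..1}" "t \<in> {0..1}" "s < t" for s t
  proof (rule DERIV_pos_imp_increasing_open[OF \<open>s < t\<close>])
    fix x assume "s < x" "x < t"
    then have "x \<in> {0..1}" "0 < x" "x < 1" using that by auto
    then show "\<exists>y. DERIV \<eta> x :> y \<and> 0 < y"
      using \<eta>[of x] J_pos[of x] by (auto simp: at_within_Icc_at intro!: exI[of _ "(J x)\<^sup>2"])
  qed (use that in \<open>auto intro: continuous_on_subset[OF \<eta>_cont]\<close>)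
  define P where "P t = 1 + (2 * \<sigma> - 1) * \<eta> t" for t
  have P_cont: "continuous_on {0..1} P"
    unfolding P_def by (intro continuous_intros \<eta>_cont)

  have key: "V t * P t = \<sigma> * (J t)\<^sup>2" if t1: "0 < t1" "t1 \<le> 1" "0 < 1 - \<delta> * \<eta> t1" and t: "t \<in> {0..t1}" for t t1
  proof -
    have sub: "s \<in> {0..1}" if "s \<in> {0..t1}" for s using that t1 by auto
    have adm: "0 < 1 - \<delta> * \<eta> s" if "s \<in> {0..t1}" for s
    proof -
      have "\<eta> s \<le> \<eta> t1"
        using \<eta>_less[of s t1] that t1 by (cases "s = t1") auto
      from mult_left_mono[OF this \<sigma>(3)] show ?thesis using t1 by linarith
    qed
    have \<eta>_nonneg: "0 \<le> \<eta> s" if "s \<in> {0..t1}" for s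
      using \<eta>_less[of 0 s] \<eta>0 sub[OF that] by (cases "s = 0") auto
    have pos: "0 < 1 + (\<sigma> - \<phi>' z) * \<eta> s" if z: "z \<in> {0..H}" and s: "s \<in> {0..t1}" for z s
    proof -
      have "- \<delta> * \<eta> s \<le> (\<sigma> - \<phi>' z) * \<eta> s"
        using P.slope_le_max_slope[OF z] \<eta>_nonneg[OF s]
        by (intro mult_right_mono) (auto simp: \<delta>_def m_def)
      then show ?thesis using adm[OF s] by linarith
    qed
    define G where "G s = integral {0..H} (\<lambda>z. 1 / (1 + (\<sigma> - \<phi>' z) * \<eta> s))" for s
    define G' where "G' s = integral {0..H} (\<lambda>z. (\<sigma> - \<phi>' z) / (1 + (\<sigma> - \<phi>' z) * \<eta> s)\<^sup>2)" for s
    have JG: "J s * G s = H" if s: "s \<in> {0..t1}" for s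
    proof (cases "s = 0")
      case True
      then show ?thesis using J0 \<eta>0 H_pos by (simp add: G_def)
    next
      case False
      then have "0 < s" "s \<le> 1" "{0..s} \<subseteq> {0..1}" using s t1 by auto
      then have "J s * integral {0..H} (\<lambda>z. 1 / (1 + (V 0 - v z 0) * \<eta> s)) = H"
        by (intro lagrangian_volume[where \<delta> = \<delta>] DERIV_subset[OF V] DERIV_subset[OF J] DERIV_subset[OF \<eta>]
              J_pos J0 \<eta>0 \<sigma>(3) adm s)
           (use init V0 P.slope_le_max_slope in \<open>auto simp: \<delta>_def m_def\<close>)
      moreover have "integral {0..H} (\<lambda>z. 1 / (1 + (V 0 - v z 0) * \<eta> s)) = G s"
        unfolding G_def V0 by (rule integral_cong) (simp add: init)
      ultimately show ?thesis by simp
    qed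
    have G_deriv: "(G has_real_derivative - (J t)\<^sup>2 * G' t) (at t within {0..t1})"
    proof -
      have "((\<lambda>s. integral (cbox 0 H) (\<lambda>z. 1 / (1 + (\<sigma> - \<phi>' z) * \<eta> s))) has_real_derivative
          integral (cbox 0 H) (\<lambda>z. - (J t)\<^sup>2 * ((\<sigma> - \<phi>' z) / (1 + (\<sigma> - \<phi>' z) * \<eta> t)\<^sup>2))) (at t within {0..t1})"
      proof (rule leibniz_rule_field_derivative)
        fix s z assume s: "s \<in> {0..t1}" and "z \<in> cbox 0 H"
        then have ne: "1 + (\<sigma> - \<phi>' z) * \<eta> s \<noteq> 0" using pos[of z s] by auto
        have \<eta>_s: "(\<eta> has_real_derivative (J s)\<^sup>2) (at s within {0..t1})"
          by (rule DERIV_subset[OF \<eta>[OF sub[OF s]]]) (use t1 in auto)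
        show "((\<lambda>s. 1 / (1 + (\<sigma> - \<phi>' z) * \<eta> s)) has_real_derivative
            - (J s)\<^sup>2 * ((\<sigma> - \<phi>' z) / (1 + (\<sigma> - \<phi>' z) * \<eta> s)\<^sup>2)) (at s within {0..t1})"
          using ne by (auto intro!: derivative_eq_intros \<eta>_s simp: power2_eq_square)
      next
        fix s assume s: "s \<in> {0..t1}"
        have "1 + (\<sigma> - \<phi>' z) * \<eta> s \<noteq> 0" if "z \<in> {0..H}" for z using pos[OF that s] by simp
        then show "(\<lambda>z. 1 / (1 + (\<sigma> - \<phi>' z) * \<eta> s)) integrable_on cbox 0 H"
          by (auto intro!: integrable_continuous_interval continuous_intros P.slope_cont)
      next
        have c1: "continuous_on ({0..t1} \<times> {0..H}) (\<lambda>q. \<phi>' (snd q))"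
          by (rule continuous_on_compose2[OF P.slope_cont]) (auto intro!: continuous_intros)
        have c2: "continuous_on ({0..t1} \<times> {0..H}) (\<lambda>q. J (fst q))"
          by (rule continuous_on_compose2[OF J_cont]) (use t1 in \<open>auto intro!: continuous_intros\<close>)
        have c3: "continuous_on ({0..t1} \<times> {0..H}) (\<lambda>q. \<eta> (fst q))"
          by (rule continuous_on_compose2[OF \<eta>_cont]) (use t1 in \<open>auto intro!: continuous_intros\<close>)
        have ne: "1 + (\<sigma> - \<phi>' (snd q)) * \<eta> (fst q) \<noteq> 0" if "q \<in> {0..t1} \<times> {0..H}" for q
          using pos[of "snd q" "fst q"] that by auto
        show "continuous_on ({0..t1} \<times> cbox 0 H)
            (\<lambda>(s, z). - (J s)\<^sup>2 * ((\<sigma> - \<phi>' z) / (1 + (\<sigma> - \<phi>' z) * \<eta> s)\<^sup>2))"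
          unfolding case_prod_unfold box_real
          by (intro continuous_intros c1 c2 c3) (use ne in auto)
      qed (use t in auto)
      then show ?thesis
        unfolding box_real integral_mult_right G_def[abs_def] G'_def .
    qed
    have "((\<lambda>s. J s * G s) has_real_derivative V t * J t * G t + (- (J t)\<^sup>2 * G' t) * J t) (at t within {0..t1})"
      by (intro DERIV_mult DERIV_subset[OF J[OF sub[OF t]]] G_deriv) (use t1 in auto)
    then have "V t * J t * G t + (- (J t)\<^sup>2 * G' t) * J t = 0"
      by (rule real_derivative_unique_Icc[OF t1(1) t _ DERIV_const[of H]]) (use JG in auto)
    then have "J t * (V t * G t) = J t * ((J t)\<^sup>2 * G' t)" by (simp add: algebra_simps)
    then have VG: "V t * G t = (J t)\<^sup>2 * G' t" using J_pos[of t] by simp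
    have "\<sigma> * G t = P t * G' t"
      unfolding G_def G'_def P_def by (rule P.slope_moments[OF \<sigma>(1)]) (use pos t in auto)
    then have "(V t * P t) * G t = (\<sigma> * (J t)\<^sup>2) * G t"
      using VG by algebra
    moreover have "G t \<noteq> 0" using JG[OF t] H_pos by auto
    ultimately show ?thesis by simp
  qed

  (* \<eta> is strictly increasing, so the zero x found below is the first one, and key applies before it. *)
  have adm: "0 < 1 - \<delta> * \<eta> t" if t: "t \<in> {0..1}" for t
  proof (rule ccontr)
    assume neg: "\<not> 0 < 1 - \<delta> * \<eta> t"
    then have "\<delta> \<noteq> 0" by auto
    then have \<delta>: "\<delta> = - (2 * \<sigma> - 1)" "0 < \<delta>" using \<sigma>(3,4) by auto
    have "\<exists>x. 0 \<le> x \<and> x \<le> t \<and> 1 - \<delta> * \<eta> x = 0"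
      by (rule IVT2') (use neg \<eta>0 t in \<open>auto intro!: continuous_intros continuous_on_subset[OF \<eta>_cont]\<close>)
    then obtain x where "0 \<le> x" "x \<le> t" and x0: "1 - \<delta> * \<eta> x = 0" by blast
    then have x: "x \<in> {0..1}" "1 - \<delta> * \<eta> x = 0" using t by auto
    have "0 < x" using x \<eta>0 by (cases "x = 0") auto
    define s where "s n = x * (1 - inverse (real (Suc (Suc n))))" for n
    have s: "0 < s n" "s n < x" "s n \<in> {0..1}" for n
    proof -
      have q: "0 < inverse (real (Suc (Suc n)))" "inverse (real (Suc (Suc n))) < 1"
        by (auto simp: field_simps)
      have "0 < x * inverse (real (Suc (Suc n)))" using \<open>0 < x\<close> q(1) by (rule mult_pos_pos)
      then show "s n < x" by (simp add: s_def right_diff_distrib)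
      show "0 < s n" unfolding s_def using \<open>0 < x\<close> q(2) by (intro mult_pos_pos) auto
      with \<open>s n < x\<close> show "s n \<in> {0..1}" using x(1) by simp
    qed
    have "s \<longlonglongrightarrow> x * (1 - 0)"
      unfolding s_def by (intro tendsto_intros LIMSEQ_Suc[OF LIMSEQ_inverse_real_of_nat])
    then have "s \<longlonglongrightarrow> x" by simp
    then have "(\<lambda>n. V (s n) * P (s n) - \<sigma> * (J (s n))\<^sup>2) \<longlonglongrightarrow> V x * P x - \<sigma> * (J x)\<^sup>2"
      using s x by (intro continuous_on_tendsto_compose[of "{0..1}" "\<lambda>t. V t * P t - \<sigma> * (J t)\<^sup>2"]
        continuous_intros V_cont P_cont J_cont) auto
    moreover have "V (s n) * P (s n) - \<sigma> * (J (s n))\<^sup>2 = 0" for n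
    proof -
      have "\<delta> * \<eta> (s n) < \<delta> * \<eta> x"
        using \<eta>_less[OF s(3) x(1) s(2)] \<delta>(2) by (rule mult_strict_left_mono)
      then show ?thesis using key[of "s n" "s n"] s[of n] x(2) by auto
    qed
    ultimately have "V x * P x = \<sigma> * (J x)\<^sup>2"
      by (simp add: LIMSEQ_const_iff)
    moreover have "P x = 0" using x(2) \<delta>(1) by (simp add: P_def algebra_simps)
    ultimately show False using \<sigma>(2) J_pos[of x] by simp
  qed
  have VP: "V t * P t = \<sigma> * (J t)\<^sup>2" if "t \<in> {0..1}" for t
    using key[of 1 t] adm[of 1] that by simp
  have quot: "((\<lambda>t. P t / (J t)\<^sup>2 + t) has_real_derivative 0) (at t within {0..1})" if t: "t \<in> {0..1}" for t
  proof -
    have "((\<lambda>t. P t / (J t)\<^sup>2 + t) has_real_derivative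
        ((2 * \<sigma> - 1) * (J t)\<^sup>2 * (J t)\<^sup>2 - P t * (2 * J t * (V t * J t))) / ((J t)\<^sup>2 * (J t)\<^sup>2) + 1) (at t within {0..1})"
      unfolding P_def using J_pos[of t] by (auto intro!: derivative_eq_intros J[OF t] \<eta>[OF t])
    moreover have "(2 * \<sigma> - 1) * (J t)\<^sup>2 * (J t)\<^sup>2 - P t * (2 * J t * (V t * J t)) = - ((J t)\<^sup>2 * (J t)\<^sup>2)"
      using VP[OF t] by algebra
    ultimately show ?thesis using J_pos[of t] by simp
  qed
  obtain k where k: "\<forall>t\<in>{0..1}. P t / (J t)\<^sup>2 + t = k"
    using has_field_derivative_zero_constant[OF convex_real_interval(5) quot] by blast
  have "k = 1" using bspec[OF k, of 0] J0 \<eta>0 by (simp add: P_def)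
  then have "P 1 = 0" using bspec[OF k, of 1] J_pos[of 1] by simp
  then show False using VP[of 1] \<sigma>(2) J_pos[of 1] by simp
qed

theorem theorem2:
  fixes H L :: real and k :: nat and \<phi> :: "real \<Rightarrow> real"
    and r :: enat and T :: ereal and u w :: field
  assumes "H > 0" and "L > 0"
    and "profile_solution H \<phi>" and "\<exists>z\<in>{0..H}. \<phi> z \<noteq> 0"
    and "k \<ge> 1"
    and "r \<ge> 1" and "T > 0"
    and "smooth_PE_solution r H L T u w"
    and "initial_value H u w
           (\<lambda>x z. - L / (2 * pi * real k) * sin (2 * pi * real k / L * x) * zderiv H \<phi> z)
           (\<lambda>x z. cos (2 * pi * real k / L * x) * \<phi> z)"
  shows "blows_up_in_finite_time r H L T u w"
proof -
  have "T' \<le> 1" if cont: "smooth_continuation r H L T u w T' u' w'" for T' u' w'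
  proof (rule ccontr)
    assume "\<not> T' \<le> 1"
    then have T': "ereal 1 < T'" by (simp add: one_ereal_def)
    from cont have sol: "smooth_PE_solution r H L T' u' w'"
      and same: "\<And>x z t. z \<in> {0..H} \<Longrightarrow> t \<in> time_set T \<Longrightarrow> w' x z t = w x z t"
      by (auto simp: smooth_continuation_def)
    from sol obtain p where smooth: "smooth_field r H T' u'" "smooth_field r H T' w'" "smooth_field r H T' p"
      and PE: "primitive_equations H T' u' w' p" and bc: "no_flow_through H T' w'" and odd: "odd_x H T' u'"
      by (auto simp: smooth_PE_solution_def)
    have sub: "t \<in> time_set T'" if "t \<in> {0..1}" for t
      using that T' by (auto simp: time_set_def intro: le_less_trans[of "ereal t" "ereal 1"])
    note C1 = smooth_field_C1[OF _ assms(6,1) zero_less_one T']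
    have flow: "reduced_flow H 1 (w' 0) (partial_z H w' 0) (partial_t T' w' 0)"
    proof (rule axis_reduction[OF assms(1) zero_less_one C1[OF smooth(1)] C1[OF smooth(2)] C1[OF smooth(3)]])
      show "u' 0 z t = 0" if "z \<in> {0..H}" "t \<in> {0..1}" for z t
      proof -
        have "u' 0 z t = - u' (- 0) z t"
          using odd that sub unfolding odd_x_def by blast
        then show ?thesis by simp
      qed
    qed (use PE bc sub in \<open>auto simp: primitive_equations_def no_flow_through_def\<close>)
    have init: "w' 0 z 0 = \<phi> z" if "z \<in> {0..H}" for z
      using same[OF that, of 0 0] assms(7,9) that
      by (simp add: initial_value_def time_set_def zero_ereal_def)
    interpret profile H \<phi> "zderiv H \<phi>" "zderiv H (zderiv H \<phi>)"
      "2 / H * integral {0..H} (\<lambda>s. (zderiv H \<phi> s)\<^sup>2)"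
      using assms by (intro profile_solution_profile)
    have "partial_z H w' 0 z 0 = zderiv H \<phi> z" if z: "z \<in> {0..H}" for z
      by (rule real_derivative_unique_Icc[OF assms(1) z reduced_flow.W_z[OF flow z] \<phi>_deriv[OF z]])
         (use init in auto)
    from no_unit_time_flow[OF flow profile_axioms this] show False .
  qed
  then have "lifespan r H L T u w \<le> 1"
    unfolding lifespan_def by (intro Sup_least) blast
  then show ?thesis
    unfolding blows_up_in_finite_time_def by (auto intro: le_less_trans)
qed

end
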